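(* Let $\mathcal{X}$ be a non-symmetric shift operator with shift $h$ obtained from a symmetric shift operator $X\in\mathcal{S}(h)$ through one of the following two constructions. (i) Koornwinder construction: if \[ \mathcal{X}=\mathcal{B}_{\mathrm{K},k+h}\begin{pmatrix}X_k&0\\0&q^{-\frac{|h\cdot v_3|+|h\cdot v_4|}{2}}X_{k+\epsilon_1+\epsilon_2}\end{pmatrix}\mathcal{B}_{\mathrm{K},k}^{-1}, \] where $h\cdot v_1=h\cdot v_2=0$ and $X=S_{\delta_3v_3}^{\circ n_3}\circ S_{\delta_4v_4}^{\circ n_4}$ with $\delta_i\in\{\pm1\}$, $n_i\in\mathbb{N}_0$, $h=\delta_3n_3v_3+\delta_4n_4v_4$, then $\mathcal{X}$ restricts to $X$ on $\mathcal{A}_0$. In particular, $\mathcal{E}^q_{2,+}$ and $\mathcal{E}^q_{2,-}$ restrict to $E^q_{13}$ and $E^q_{24}$ on $\mathcal{A}_0$, respectively. (ii) Steinberg construction: if \[ \mathcal{X}=\mathcal{B}_{\mathrm{S}}V_{k+h}\begin{pmatrix}X_{k+\epsilon_1}&0\\0&X_{k+\epsilon_2}\end{pmatrix}V_k^{-1}\mathcal{B}_{\mathrm{S}}^{-1}, \] where $h\cdot v_3=h\cdot v_4=0$ and the coefficients of $\widetilde{\eta}_h(X)$ depend only on $ab$ and $cd$ (lie in $\mathbb{Q}(\sqrt{-ab},\sqrt{-cd},q^{1/2})$), then $\mathcal{X}$ need not restrict to an operator on $\mathcal{A}_0$, but a sufficient condition is $X_{k+\epsilon_1}=X_{k+\epsilon_2}=X_k$;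 in that case $\mathcal{X}$ restricts to $q^{-h_1}X$ on $\mathcal{A}_0$. In particular, $\mathcal{G}^q_+$ and $\mathcal{E}^q_{1,-}$ restrict to $q^{-1/2}G^q_+$ and $q^{-1/2}E^q_{34}$ on $\mathcal{A}_0$, respectively. Moreover, $\mathcal{G}^q_-$ and $\mathcal{E}^q_{1,+}$ do not restrict to operators on $\mathcal{A}_0$ (they do not map $\mathcal{A}_0$ into $\mathcal{A}_0$).
   Context: Let $K=\mathbb{Q}(\sqrt{-ab},b,\sqrt{-cd},d,q^{1/2})$ be the field of rational functions in the five indeterminates $\sqrt{-ab},b,\sqrt{-cd},d,q^{1/2}$; put $a=-(\sqrt{-ab})^2/b$, $c=-(\sqrt{-cd})^2/d$. Let $*$ be the field involution of $K$ inverting the five generators. Let $\mathcal{A}=K[z,z^{-1}]$ and $\mathcal{A}_0=\{f\in\mathcal{A}: f(z)=f(z^{-1})\}$. For $f=\sum_n f_nz^n$ put $f^*=\sum_n f_n^*z^{-n}$. Write $(x;q)_\infty=\prod_{j\ge0}(1-xq^j)$ and $(x_1,\dots,x_r;q)_\infty=\prod_i(x_i;q)_\infty$. Let \[ \Delta=\frac{(z^2,qz^{-2};q)_\infty}{(az,bz,cz,dz,aqz^{-1},bqz^{-1},cz^{-1},dz^{-1};q)_\infty}, \] expanded as a power series in $z$ and $q^{1/2}z^{-1}$ with coefficients in $\mathcal{R}=\mathbb{Q}[a^{\pm1},b^{\pm1},(cq^{-1/2})^{\pm1},(dq^{-1/2})^{\pm1}]$, hence regarded as an element of $\mathcal{R}((q^{1/2}))[[z^{\pm1}]]$.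 With $\mathrm{ct}$ denoting the coefficient of $z^0$, put $(f,g)=\mathrm{ct}(fg^*\Delta)\in K\otimes_{\mathcal{R}[q^{\pm1/2}]}\mathcal{R}((q^{1/2}))$. The symmetric Askey--Wilson polynomial $P_n=P_{n,k}\in\mathcal{A}_0$ ($n\in\mathbb{N}_0$) is the unique element with $P_0=1$ and, for $n\ge1$, $P_n=z^n+z^{-n}+$ (a $K$-linear combination of $z^j+z^{-j}$, $0\le j<n$), such that $(P_n,z^m+z^{-m})=0$ for $0\le m<n$. Here $k$ is a formal label for $(a,b,c,d)$; for $h\in\mathbb{Q}^4$ the subscript $k+h$ (on polynomials, scalars, operators) means that $(a,b,c,d)$ is replaced by $(aq^{h_1},bq^{h_2},cq^{h_3},dq^{h_4})$ and $\sqrt{-ab},\sqrt{-cd}$ by $q^{(h_1+h_2)/2}\sqrt{-ab},q^{(h_3+h_4)/2}\sqrt{-cd}$. Put $P_n=0$ for $n\notin\mathbb{N}_0$. $\epsilon_1,\dots,\epsilon_4$ is the standard basis of $\mathbb{Q}^4$; $v_1=\frac12(1,1,1,1)$, $v_2=\frac12(1,1,-1,-1)$, $v_3=\frac12(1,-1,1,-1)$, $v_4=\frac12(1,-1,-1,1)$. Let $(Tf)(z)=f(q^{1/2}z)$. A symmetric shift operator $X\in\mathcal{S}(h)$ is a finite sum $X=X_k=\sum_nc_n(z)T^n$, $c_n\in K(z)$, with $X\mathcal{A}_0\subset\mathcal{A}_0$ such that for every $m\in\mathbb{N}_0$ there is $C\in K$ with $X_kP_{m,k}=CP_{m-h\cdot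 v_1,k+h}$. Expanding coefficients in $K((z^{-1}))$, there is a unique expansion $X=\sum_{n\ge0}z^{-h\cdot v_1-n}\alpha_n(T)$ with $\alpha_n\in K[T,T^{-1}]$, and $\widetilde\eta_h(X)=\alpha_0(T)$. For $S\in\mathcal{S}(h)$, $S'\in\mathcal{S}(h')$ put $(S\circ S')_k=S_{k+h'}S'_k$. Define \[ G^q_+=\frac{T-T^{-1}}{z-z^{-1}},\qquad G^q_-=\frac{A_1(z)T-A_1(z^{-1})T^{-1}}{z-z^{-1}},\qquad E^q_{ij}=\frac{A_{ij}(z)T-A_{ij}(z^{-1})T^{-1}}{z-z^{-1}}, \] where $A_1(z)=q^{-1/2}z^{-2}\prod_{u\in\{a,b,c,d\}}(1-uq^{-1/2}z)$, $A_{ij}(z)=-z^{-1}(1-u_iq^{-1/2}z)(1-u_jq^{-1/2}z)$, $(u_1,u_2,u_3,u_4)=(a,b,c,d)$. Put $S_{-v_3}=E^q_{13}$, $S_{v_3}=E^q_{24}$, $S_{-v_4}=E^q_{14}$, $S_{v_4}=E^q_{23}$. Let $V_k=\begin{pmatrix}-a^{-1}&-b^{-1}\\1&1\end{pmatrix}$ and let $\mathcal{B}_{\mathrm{S}},\mathcal{B}_{\mathrm{K},k}:\mathcal{A}_0^2\to\mathcal{A}$ be the isomorphisms $\mathcal{B}_{\mathrm{S}}(f_1,f_2)^T=f_1+zf_2$, $\mathcal{B}_{\mathrm{K},k}(f_1,f_2)^T=f_1+z^{-1}(1-az)(1-bz)f_2$. $\mathcal{G}^q_+,\mathcal{G}^q_-,\mathcal{E}^q_{1,+},\mathcal{E}^q_{1,-}$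 are obtained by the Steinberg construction in (ii) from $X=G^q_+,G^q_-,E^q_{12},E^q_{34}$ with $h=v_1,-v_1,-v_2,v_2$, respectively; $\mathcal{E}^q_{2,+},\mathcal{E}^q_{2,-}$ are obtained by the Koornwinder construction in (i) from $X=E^q_{13},E^q_{24}$ with $h=-v_3,v_3$, respectively. *)

theory Defs
  imports "HOL-Analysis.Analysis" "HOL-Library.Poly_Mapping"
    "HOL-Computational_Algebra.Computational_Algebra"
begin

section \<open>Extending substitutions to polynomials and to fraction fields\<close>

definition poly_ext :: "('a::zero \<Rightarrow> 'b::comm_semiring_0) \<Rightarrow> 'b \<Rightarrow> 'a poly \<Rightarrow> 'b" where
  "poly_ext \<phi> x p = poly (map_poly \<phi> p) x"

text \<open>If \<open>ev\<close> is an injective ring homomorphism, then \<open>frac_ext ev\<close> is its unique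
  extension to a field homomorphism. Below, \<open>ev\<close> is always a substitution of
  algebraically independent elements for the indeterminates, hence injective.\<close>

definition frac_ext :: "('a::idom \<Rightarrow> 'b::field) \<Rightarrow> 'a fract \<Rightarrow> 'b" where
  "frac_ext ev x = (THE y. \<exists>p r. r \<noteq> 0 \<and> ev r \<noteq> 0 \<and> x = Fract p r \<and> y = ev p / ev r)"


section \<open>The field of parameters\<close>

text \<open>The rational functions over the rationals in \<open>\<surd>(-ab), b, \<surd>(-cd), d, q\<^sup>1\<^sup>/\<^sup>2\<close>,
  as iterated polynomials with \<open>\<surd>(-ab)\<close> the innermost and \<open>q\<^sup>1\<^sup>/\<^sup>2\<close> the outermost variable.\<close>

type_synonym pfield = "rat poly poly poly poly poly fract"

definition sqrt_mab :: pfield where "sqrt_mab = Fract [:[:[:[:[:0, 1:]:]:]:]:] 1"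
definition par_b :: pfield where "par_b = Fract [:[:[:[:0, 1:]:]:]:] 1"
definition sqrt_mcd :: pfield where "sqrt_mcd = Fract [:[:[:0, 1:]:]:] 1"
definition par_d :: pfield where "par_d = Fract [:[:0, 1:]:] 1"
definition sqrt_q :: pfield where "sqrt_q = Fract [:0, 1:] 1"

definition par_a :: pfield where "par_a = - (sqrt_mab ^ 2) / par_b"
definition par_c :: pfield where "par_c = - (sqrt_mcd ^ 2) / par_d"

definition pars :: "pfield ^ 4" where "pars = vector [par_a, par_b, par_c, par_d]"

text \<open>Substitution of elements of a field for the five generators, in the above order.\<close>

definition psubst ::
  "'b::field_char_0 \<Rightarrow> 'b \<Rightarrow> 'b \<Rightarrow> 'b \<Rightarrow> 'b \<Rightarrow> pfield \<Rightarrow> 'b" where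
  "psubst x1 x2 x3 x4 x5 =
     frac_ext (poly_ext (poly_ext (poly_ext (poly_ext (poly_ext of_rat x1) x2) x3) x4) x5)"

definition pstar :: "pfield \<Rightarrow> pfield" where
  "pstar = psubst (inverse sqrt_mab) (inverse par_b) (inverse sqrt_mcd) (inverse par_d)
     (inverse sqrt_q)"

text \<open>\<open>q\<^sup>r\<close>, meant for \<open>r\<close> in \<open>\<int>/2\<close>.\<close>

definition qpow :: "rat \<Rightarrow> pfield" where
  "qpow r = sqrt_q powi \<lfloor>2 * r\<rfloor>"

text \<open>The \<open>h\<close> for which all powers of \<open>q\<close> needed for the substitution \<open>k \<mapsto> k + h\<close>
  lie in the field of parameters.\<close>

definition shifts :: "(rat ^ 4) set" where
  "shifts = {h. 2 * h $ 2 \<in> \<int> \<and> 2 * h $ 4 \<in> \<int> \<and> h $ 1 + h $ 2 \<in> \<int> \<and> h $ 3 + h $ 4 \<in> \<int>}"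

text \<open>The effect of \<open>k \<mapsto> k + h\<close> on scalars. As \<open>a = -(\<surd>(-ab))\<^sup>2 / b\<close>, this maps \<open>a\<close> to
  \<open>a q\<^sup>h\<^sup>1\<close>, and similarly for \<open>c\<close>.\<close>

definition pshift :: "rat ^ 4 \<Rightarrow> pfield \<Rightarrow> pfield" where
  "pshift h = psubst (qpow ((h $ 1 + h $ 2) / 2) * sqrt_mab) (qpow (h $ 2) * par_b)
     (qpow ((h $ 3 + h $ 4) / 2) * sqrt_mcd) (qpow (h $ 4) * par_d) sqrt_q"

definition dotp :: "rat ^ 4 \<Rightarrow> rat ^ 4 \<Rightarrow> rat" where
  "dotp u v = (\<Sum>i\<in>UNIV. u $ i * v $ i)"

definition v1 :: "rat ^ 4" where "v1 = (1/2) *s vector [1, 1, 1, 1]"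
definition v2 :: "rat ^ 4" where "v2 = (1/2) *s vector [1, 1, -1, -1]"
definition v3 :: "rat ^ 4" where "v3 = (1/2) *s vector [1, -1, 1, -1]"
definition v4 :: "rat ^ 4" where "v4 = (1/2) *s vector [1, -1, -1, 1]"

text \<open>The subfield generated by a set.\<close>

inductive_set subfield_gen :: "'a::field set \<Rightarrow> 'a set" for G where
  gen: "x \<in> G \<Longrightarrow> x \<in> subfield_gen G"
| one: "1 \<in> subfield_gen G"
| diff: "x \<in> subfield_gen G \<Longrightarrow> y \<in> subfield_gen G \<Longrightarrow> x - y \<in> subfield_gen G"
| mult: "x \<in> subfield_gen G \<Longrightarrow> y \<in> subfield_gen G \<Longrightarrow> x * y \<in> subfield_gen G"
| inv: "x \<in> subfield_gen G \<Longrightarrow> inverse x \<in> subfield_gen G"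


section \<open>Laurent polynomials and rational functions in z\<close>

text \<open>A Laurent polynomial is the finitely supported family of its coefficients;
  the ring structure of \<open>\<Rightarrow>\<^sub>0\<close> is the convolution product.\<close>

type_synonym lpoly = "int \<Rightarrow>\<^sub>0 pfield"
type_synonym zfield = "pfield poly fract"

definition zvar :: zfield where "zvar = Fract [:0, 1:] 1"
definition const :: "pfield \<Rightarrow> zfield" where "const c = Fract [:c:] 1"

definition to_zfield :: "lpoly \<Rightarrow> zfield" where
  "to_zfield f = (\<Sum>n\<in>Poly_Mapping.keys f. const (Poly_Mapping.lookup f n) * zvar powi n)"

definition sym_lpolys :: "zfield set" where
  "sym_lpolys =
     to_zfield ` {f. \<forall>n. Poly_Mapping.lookup f n = Poly_Mapping.lookup f (- n)}"

text \<open>Apply \<open>\<phi>\<close> to the coefficients and substitute \<open>w\<close> for \<open>z\<close>.\<close>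

definition zsubst :: "(pfield \<Rightarrow> 'b) \<Rightarrow> 'b::field \<Rightarrow> zfield \<Rightarrow> 'b" where
  "zsubst \<phi> w = frac_ext (poly_ext \<phi> w)"

definition T_pow :: "int \<Rightarrow> zfield \<Rightarrow> zfield" where
  "T_pow n = zsubst const (const (sqrt_q powi n) * zvar)"

definition zshift :: "rat ^ 4 \<Rightarrow> zfield \<Rightarrow> zfield" where
  "zshift h = zsubst (\<lambda>c. const (pshift h c)) zvar"

definition lshift :: "rat ^ 4 \<Rightarrow> lpoly \<Rightarrow> lpoly" where
  "lshift h = Poly_Mapping.map (pshift h)"

definition lstar :: "lpoly \<Rightarrow> lpoly" where
  "lstar f = Poly_Mapping.map_key uminus (Poly_Mapping.map pstar f)"

text \<open>Expansion in \<open>K((z\<^sup>-\<^sup>1))\<close>: the variable of the Laurent series is \<open>z\<^sup>-\<^sup>1\<close>.\<close>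

definition expand_inf :: "zfield \<Rightarrow> pfield fls" where
  "expand_inf = zsubst fls_const fls_X_inv"


section \<open>The inner product and the Askey--Wilson polynomials\<close>

text \<open>Write \<open>t = q\<^sup>1\<^sup>/\<^sup>2\<close>. The coefficients of \<open>\<Delta>\<close> are polynomials in
  \<open>a\<close>, \<open>b\<close>, \<open>c/t\<close>, \<open>d/t\<close>, and \<open>R((t))\<close> as well as its tensor product with \<open>K\<close> over
  \<open>R[t, 1/t]\<close> embed into \<open>F((t))\<close>, where \<open>F\<close> is the field of rational functions in
  \<open>\<surd>(-ab), b, \<surd>(-cd)/t, d/t\<close>. This is the codomain of the inner product.\<close>

type_synonym cfield = "rat poly poly poly poly fract"

definition c_sqrt_mab :: cfield where "c_sqrt_mab = Fract [:[:[:[:0, 1:]:]:]:] 1"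
definition c_b :: cfield where "c_b = Fract [:[:[:0, 1:]:]:] 1"
definition c_sqrt_mcd :: cfield where "c_sqrt_mcd = Fract [:[:0, 1:]:] 1" \<comment> \<open>\<open>\<surd>(-cd)/t\<close>\<close>
definition c_d :: cfield where "c_d = Fract [:0, 1:] 1" \<comment> \<open>\<open>d/t\<close>\<close>

definition pfield_to_fls :: "pfield \<Rightarrow> cfield fls" where
  "pfield_to_fls = psubst (fls_const c_sqrt_mab) (fls_const c_b) (fls_X * fls_const c_sqrt_mcd)
     (fls_X * fls_const c_d) fls_X"

text \<open>The weight lives in \<open>F((z))[[t]]\<close>, with inner variable \<open>z\<close> and outer variable \<open>t\<close>.
  This ring contains the power series in \<open>z\<close> and \<open>t/z\<close>, and inversion in it
  expands \<open>1 - a z\<close> in powers of \<open>z\<close> and \<open>1 - a q/z\<close> in powers of \<open>t\<close>. Limits are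
  taken in the \<open>t\<close>-adic topology.\<close>

type_synonym wring = "cfield fls fps"

definition w_z :: wring where "w_z = fps_const fls_X"
definition w_zinv :: wring where "w_zinv = fps_const fls_X_inv"
definition w_q :: wring where "w_q = fps_X ^ 2"
definition w_const :: "cfield \<Rightarrow> wring" where "w_const x = fps_const (fls_const x)"
definition w_a :: wring where "w_a = w_const (- (c_sqrt_mab ^ 2) / c_b)"
definition w_b :: wring where "w_b = w_const c_b"
definition w_c :: wring where "w_c = w_const (- (c_sqrt_mcd ^ 2) / c_d) * fps_X"
definition w_d :: wring where "w_d = w_const c_d * fps_X"

definition qpoch :: "wring \<Rightarrow> wring" where
  "qpoch x = lim (\<lambda>N. \<Prod>j<N. 1 - x * w_q ^ j)"

definition weight :: wring where
  "weight = qpoch (w_z ^ 2) * qpoch (w_q * w_zinv ^ 2) *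
     inverse (qpoch (w_a * w_z) * qpoch (w_b * w_z) * qpoch (w_c * w_z) * qpoch (w_d * w_z) *
       qpoch (w_a * w_q * w_zinv) * qpoch (w_b * w_q * w_zinv) *
       qpoch (w_c * w_zinv) * qpoch (w_d * w_zinv))"

definition weight_coeff :: "int \<Rightarrow> cfield fls" where
  "weight_coeff n = fps_to_fls (Abs_fps (\<lambda>j. fls_nth (fps_nth weight j) n))"

definition pairing :: "lpoly \<Rightarrow> lpoly \<Rightarrow> cfield fls" where
  "pairing f g = (\<Sum>n\<in>Poly_Mapping.keys (f * lstar g).
     pfield_to_fls (Poly_Mapping.lookup (f * lstar g) n) * weight_coeff (- n))"

definition msym :: "nat \<Rightarrow> lpoly" where
  "msym n = Poly_Mapping.single (int n) 1 + Poly_Mapping.single (- int n) 1"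

definition AW :: "nat \<Rightarrow> lpoly" where
  "AW n = (if n = 0 then 1 else
     (THE p. (\<exists>c. p = msym n + (\<Sum>j<n. Poly_Mapping.single 0 (c j) * msym j)) \<and>
             (\<forall>m<n. pairing p (msym m) = 0)))"

definition AW_ext :: "rat \<Rightarrow> lpoly" where
  "AW_ext x = (if x \<in> \<nat> then AW (nat \<lfloor>x\<rfloor>) else 0)"


section \<open>q-difference operators and symmetric shift operators\<close>

text \<open>\<open>X\<close> stands for the operator \<open>\<Sum>\<^sub>n X\<^sub>n(z) T\<^sup>n\<close>.\<close>

type_synonym qdiff = "int \<Rightarrow>\<^sub>0 zfield"

definition act :: "qdiff \<Rightarrow> zfield \<Rightarrow> zfield" where
  "act X f = (\<Sum>n\<in>Poly_Mapping.keys X. Poly_Mapping.lookup X n * T_pow n f)"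

definition qdiff_comp :: "qdiff \<Rightarrow> qdiff \<Rightarrow> qdiff" where
  "qdiff_comp X Y = (\<Sum>n\<in>Poly_Mapping.keys X. \<Sum>m\<in>Poly_Mapping.keys Y.
     Poly_Mapping.single (n + m)
       (Poly_Mapping.lookup X n * T_pow n (Poly_Mapping.lookup Y m)))"

definition opshift :: "rat ^ 4 \<Rightarrow> qdiff \<Rightarrow> qdiff" where
  "opshift h = Poly_Mapping.map (zshift h)"

definition sym_shift_ops :: "rat ^ 4 \<Rightarrow> qdiff set" where
  "sym_shift_ops h = {X. act X ` sym_lpolys \<subseteq> sym_lpolys \<and>
     (\<forall>m. \<exists>C. act X (to_zfield (AW m)) =
        const C * to_zfield (lshift h (AW_ext (of_nat m - dotp h v1))))}"

text \<open>The coefficient of \<open>z\<close> to the power \<open>- h \<cdot> v\<^sub>1\<close> in the expansion of \<open>X\<close>. If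
  \<open>h \<cdot> v\<^sub>1\<close> is not an integer, the zero operator is the only symmetric shift operator with
  shift \<open>h\<close>.\<close>

definition eta :: "rat ^ 4 \<Rightarrow> qdiff \<Rightarrow> (int \<Rightarrow>\<^sub>0 pfield)" where
  "eta h X = Poly_Mapping.map (\<lambda>c. fls_nth (expand_inf c) \<lfloor>dotp h v1\<rfloor>) X"

text \<open>\<open>S \<circ> S'\<close>, where \<open>h'\<close> is the shift of \<open>S'\<close>, and the powers of \<open>S\<close>, where \<open>h\<close> is the
  shift of \<open>S\<close>.\<close>

definition shift_comp :: "rat ^ 4 \<Rightarrow> qdiff \<Rightarrow> qdiff \<Rightarrow> qdiff" where
  "shift_comp h' S S' = qdiff_comp (opshift h' S) S'"

fun shift_power :: "rat ^ 4 \<Rightarrow> qdiff \<Rightarrow> nat \<Rightarrow> qdiff" where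
  "shift_power h S 0 = Poly_Mapping.single 0 1"
| "shift_power h S (Suc n) = shift_comp (of_nat n *s h) S (shift_power h S n)"

definition G_plus :: qdiff where
  "G_plus = Poly_Mapping.single 1 (1 / (zvar - inverse zvar))
          - Poly_Mapping.single (-1) (1 / (zvar - inverse zvar))"

definition A1 :: "zfield \<Rightarrow> zfield" where
  "A1 w = const (inverse sqrt_q) * w powi (-2) * (\<Prod>i\<in>UNIV. 1 - const (pars $ i / sqrt_q) * w)"

definition G_minus :: qdiff where
  "G_minus = Poly_Mapping.single 1 (A1 zvar / (zvar - inverse zvar))
           - Poly_Mapping.single (-1) (A1 (inverse zvar) / (zvar - inverse zvar))"

definition A_pair :: "4 \<Rightarrow> 4 \<Rightarrow> zfield \<Rightarrow> zfield" where
  "A_pair i j w =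
     - inverse w * (1 - const (pars $ i / sqrt_q) * w) * (1 - const (pars $ j / sqrt_q) * w)"

definition E_op :: "4 \<Rightarrow> 4 \<Rightarrow> qdiff" where
  "E_op i j = Poly_Mapping.single 1 (A_pair i j zvar / (zvar - inverse zvar))
            - Poly_Mapping.single (-1) (A_pair i j (inverse zvar) / (zvar - inverse zvar))"

text \<open>\<open>S\<close> with index \<open>\<delta> v\<^sub>3\<close>, respectively \<open>\<delta> v\<^sub>4\<close>, for a sign \<open>\<delta>\<close>.\<close>

definition S3 :: "rat \<Rightarrow> qdiff" where
  "S3 \<delta> = (if \<delta> = 1 then E_op 2 4 else E_op 1 3)"

definition S4 :: "rat \<Rightarrow> qdiff" where
  "S4 \<delta> = (if \<delta> = 1 then E_op 2 3 else E_op 1 4)"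


section \<open>The Koornwinder and Steinberg constructions\<close>

definition sym_pairs :: "(zfield ^ 2) set" where
  "sym_pairs = {u. \<forall>i. u $ i \<in> sym_lpolys}"

definition B_K :: "pfield \<Rightarrow> pfield \<Rightarrow> zfield ^ 2 \<Rightarrow> zfield" where
  "B_K a b u = u $ 1 + inverse zvar * (1 - const a * zvar) * (1 - const b * zvar) * u $ 2"

definition B_S :: "zfield ^ 2 \<Rightarrow> zfield" where
  "B_S u = u $ 1 + zvar * u $ 2"

definition V :: "pfield \<Rightarrow> pfield \<Rightarrow> zfield ^ 2 ^ 2" where
  "V a b = vector [vector [- const (inverse a), - const (inverse b)], vector [1, 1]]"

definition koornwinder :: "rat ^ 4 \<Rightarrow> qdiff \<Rightarrow> zfield \<Rightarrow> zfield" where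
  "koornwinder h X f =
     (let u = inv_into sym_pairs (B_K par_a par_b) f
      in B_K (pshift h par_a) (pshift h par_b)
           (vector [act X (u $ 1),
                    const (qpow (- ((\<bar>dotp h v3\<bar> + \<bar>dotp h v4\<bar>) / 2))) *
                      act (opshift (axis 1 1 + axis 2 1) X) (u $ 2)]))"

definition steinberg :: "rat ^ 4 \<Rightarrow> qdiff \<Rightarrow> zfield \<Rightarrow> zfield" where
  "steinberg h X f =
     (let u = matrix_inv (V par_a par_b) *v inv_into sym_pairs B_S f
      in B_S (V (pshift h par_a) (pshift h par_b) *v
           vector [act (opshift (axis 1 1) X) (u $ 1), act (opshift (axis 2 1) X) (u $ 2)]))"

text \<open>The conditions on \<open>h\<close> and \<open>X\<close> for the two constructions, in addition to \<open>X\<close> being a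
  symmetric shift operator with shift \<open>h\<close>.\<close>

definition koornwinder_cond :: "rat ^ 4 \<Rightarrow> qdiff \<Rightarrow> bool" where
  "koornwinder_cond h X \<longleftrightarrow> dotp h v1 = 0 \<and> dotp h v2 = 0 \<and>
     (\<exists>\<delta>3\<in>{1, -1}. \<exists>\<delta>4\<in>{1, -1}. \<exists>n3 n4.
        h = (\<delta>3 * of_nat n3) *s v3 + (\<delta>4 * of_nat n4) *s v4 \<and>
        X = shift_comp ((\<delta>4 * of_nat n4) *s v4)
              (shift_power (\<delta>3 *s v3) (S3 \<delta>3) n3) (shift_power (\<delta>4 *s v4) (S4 \<delta>4) n4))"

definition steinberg_cond :: "rat ^ 4 \<Rightarrow> qdiff \<Rightarrow> bool" where
  "steinberg_cond h X \<longleftrightarrow> dotp h v3 = 0 \<and> dotp h v4 = 0 \<and>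
     (\<forall>n. Poly_Mapping.lookup (eta h X) n \<in> subfield_gen {sqrt_mab, sqrt_mcd, sqrt_q})"

definition cG_plus :: "zfield \<Rightarrow> zfield" where "cG_plus = steinberg v1 G_plus"
definition cG_minus :: "zfield \<Rightarrow> zfield" where "cG_minus = steinberg (- v1) G_minus"
definition cE1_plus :: "zfield \<Rightarrow> zfield" where "cE1_plus = steinberg (- v2) (E_op 1 2)"
definition cE1_minus :: "zfield \<Rightarrow> zfield" where "cE1_minus = steinberg v2 (E_op 3 4)"
definition cE2_plus :: "zfield \<Rightarrow> zfield" where "cE2_plus = koornwinder (- v3) (E_op 1 3)"
definition cE2_minus :: "zfield \<Rightarrow> zfield" where "cE2_minus = koornwinder v3 (E_op 2 4)"

definition restricts :: "(zfield \<Rightarrow> zfield) \<Rightarrow> bool" where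
  "restricts F \<longleftrightarrow> F ` sym_lpolys \<subseteq> sym_lpolys"

definition restricts_to :: "(zfield \<Rightarrow> zfield) \<Rightarrow> (zfield \<Rightarrow> zfield) \<Rightarrow> bool" where
  "restricts_to F Y \<longleftrightarrow> restricts F \<and> (\<forall>f\<in>sym_lpolys. F f = Y f)"

end

theory Submission
  imports Defs
begin

text \<open>Write \<open>f\<^sup>\<iota>(z) = f(z\<^sup>-\<^sup>1)\<close>. A symmetric \<open>f\<close> has coordinates \<open>(f, 0)\<close> with respect to
  both isomorphisms, because \<open>z\<close> and \<open>z\<^sup>-\<^sup>1(1 - az)(1 - bz)\<close> are not \<open>\<iota>\<close>-invariant. This settles
  the Koornwinder construction. In the Steinberg construction the vector \<open>(f, 0)\<close> becomes
  \<open>D\<^sup>-\<^sup>1 (f, -f)\<close> with \<open>D = b\<^sup>-\<^sup>1 - a\<^sup>-\<^sup>1\<close>, and the result is a symmetric Laurent polynomial plus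
  \<open>z D\<^sup>-\<^sup>1 (X\<^sub>1 f - X\<^sub>2 f)\<close>, where \<open>X\<^sub>i\<close> is the operator with the \<open>i\<close>th parameter multiplied by \<open>q\<close>.
  It is symmetric if and only if \<open>X\<^sub>1 f = X\<^sub>2 f\<close>, which fails for \<open>G\<^sub>-\<close> at \<open>f = 1\<close> and for
  \<open>E\<^sub>1\<^sub>2\<close> at \<open>f = z + z\<^sup>-\<^sup>1\<close>.\<close>

unbundle no Formal_Power_Series.fps_syntax

section \<open>Ring homomorphisms\<close>

locale unital_hom =
  fixes \<phi> :: "'a::comm_ring_1 \<Rightarrow> 'b::comm_ring_1"
  assumes hom_one: "\<phi> 1 = 1"
    and hom_add: "\<phi> (x + y) = \<phi> x + \<phi> y"
    and hom_mult: "\<phi> (x * y) = \<phi> x * \<phi> y"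
begin

lemma hom_zero: "\<phi> 0 = 0"
  using hom_add[of 0 0] by simp

lemma hom_minus: "\<phi> (- x) = - \<phi> x"
  using hom_add[of x "- x"] by (simp add: hom_zero add_eq_0_iff2)

lemma hom_diff: "\<phi> (x - y) = \<phi> x - \<phi> y"
  using hom_add[of x "- y"] by (simp add: hom_minus)

lemma hom_power: "\<phi> (x ^ n) = \<phi> x ^ n"
  by (induction n) (simp_all add: hom_one hom_mult)

lemma hom_sum: "\<phi> (sum f A) = (\<Sum>i\<in>A. \<phi> (f i))"
  by (induction A rule: infinite_finite_induct) (simp_all add: hom_zero hom_add)

lemma hom_prod: "\<phi> (prod f A) = (\<Prod>i\<in>A. \<phi> (f i))"
  by (induction A rule: infinite_finite_induct) (simp_all add: hom_one hom_mult)

lemmas hom_simps = hom_zero hom_one hom_add hom_mult hom_minus hom_diff hom_power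

end

lemma unital_hom_comp:
  assumes "unital_hom \<phi>" "unital_hom \<psi>"
  shows "unital_hom (\<lambda>x. \<psi> (\<phi> x))"
  using assms by (simp add: unital_hom_def)

locale field_hom = unital_hom \<phi> for \<phi> :: "'a::field \<Rightarrow> 'b::field"
begin

lemma hom_eq_0_iff: "\<phi> x = 0 \<longleftrightarrow> x = 0"
proof
  assume "\<phi> x = 0"
  then show "x = 0"
    using hom_mult[of x "inverse x"] hom_one by (cases "x = 0") auto
qed (simp add: hom_zero)

lemma hom_inverse: "\<phi> (inverse x) = inverse (\<phi> x)"
proof (cases "x = 0")
  case False
  then have "\<phi> x * \<phi> (inverse x) = 1"
    by (metis hom_mult hom_one right_inverse)
  then show ?thesis
    by (metis inverse_unique)
qed (simp add: hom_zero)

lemma hom_divide: "\<phi> (x / y) = \<phi> x / \<phi> y"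
  by (simp add: divide_inverse hom_mult hom_inverse)

lemma hom_power_int: "\<phi> (x powi n) = \<phi> x powi n"
  by (simp add: power_int_def hom_power hom_inverse)

lemmas field_hom_simps = hom_simps hom_inverse hom_divide hom_power_int

end

lemma field_hom_comp:
  assumes "field_hom \<phi>" "field_hom \<psi>"
  shows "field_hom (\<lambda>x. \<psi> (\<phi> x))"
  using assms by (simp add: field_hom_def unital_hom_def)

lemma of_rat_hom: "unital_hom (of_rat :: rat \<Rightarrow> 'a::field_char_0)"
  by unfold_locales (simp_all add: of_rat_add of_rat_mult)

text \<open>A ring homomorphism fixes integers, hence their quotients. This brings the coefficient
  map back to \<open>of_rat\<close> after a substitution has been composed with another map.\<close>

lemma rat_hom_unique:
  fixes \<phi> :: "rat \<Rightarrow> 'a::field_char_0"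
  assumes "unital_hom \<phi>"
  shows "\<phi> = of_rat"
proof
  interpret field_hom \<phi>
    using assms by (rule field_hom.intro)
  have nat: "\<phi> (of_nat n) = of_nat n" for n
    by (induction n) (simp_all add: hom_simps)
  have int: "\<phi> (of_int i) = of_int i" for i
    by (cases i) (simp_all add: nat field_hom_simps del: of_nat_Suc)
  fix r :: rat
  obtain a b where r: "r = of_int a / of_int b"
    by (metis Rat_cases Fract_of_int_quotient)
  show "\<phi> r = of_rat r"
    unfolding r by (simp add: hom_divide int of_rat_divide)
qed

section \<open>Evaluation of polynomials along a coefficient homomorphism\<close>

lemma poly_ext_0 [simp]: "poly_ext \<phi> x 0 = 0"
  by (simp add: poly_ext_def)

context unital_hom
begin

lemma poly_ext_pCons: "poly_ext \<phi> x (pCons a p) = \<phi> a + x * poly_ext \<phi> x p"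
  by (simp add: poly_ext_def map_poly_pCons hom_zero)

lemma poly_ext_add: "poly_ext \<phi> x (p + q) = poly_ext \<phi> x p + poly_ext \<phi> x q"
  by (induction p q rule: poly_induct2)
    (simp_all add: poly_ext_pCons hom_add algebra_simps)

lemma poly_ext_smult: "poly_ext \<phi> x (smult a p) = \<phi> a * poly_ext \<phi> x p"
  by (induction p) (simp_all add: poly_ext_pCons hom_mult algebra_simps)

lemma poly_ext_hom: "unital_hom (poly_ext \<phi> x)"
proof
  show "poly_ext \<phi> x 1 = 1"
    by (simp add: one_pCons poly_ext_pCons hom_one)
  show "poly_ext \<phi> x (p + q) = poly_ext \<phi> x p + poly_ext \<phi> x q" for p q
    by (rule poly_ext_add)
  show "poly_ext \<phi> x (p * q) = poly_ext \<phi> x p * poly_ext \<phi> x q" for p q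
    by (induction p)
      (simp_all add: poly_ext_add poly_ext_smult poly_ext_pCons hom_zero algebra_simps)
qed

end

lemma hom_poly_ext:
  assumes "unital_hom \<phi>" "unital_hom \<psi>"
  shows "\<psi> (poly_ext \<phi> x p) = poly_ext (\<lambda>c. \<psi> (\<phi> c)) (\<psi> x) p"
proof -
  interpret p: unital_hom \<phi> by fact
  interpret s: unital_hom \<psi> by fact
  interpret c: unital_hom "\<lambda>c. \<psi> (\<phi> c)" by (rule unital_hom_comp) fact+
  show ?thesis
    by (induction p) (simp_all add: s.hom_simps p.poly_ext_pCons c.poly_ext_pCons)
qed

lemma const_poly_hom: "unital_hom (\<lambda>c::'a::comm_ring_1. [:c:])"
  by unfold_locales (simp_all add: one_pCons)

text \<open>The universal property of the polynomial ring. It recognises a given homomorphism, such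
  as an embedding or a composition with a polynomial, as a substitution.\<close>

lemma poly_ext_unique:
  assumes "unital_hom H"
  shows "poly_ext (\<lambda>c. H [:c:]) (H [:0, 1:]) = H"
proof
  interpret H: unital_hom H by fact
  interpret c: unital_hom "\<lambda>c. H [:c:]"
    by (rule unital_hom_comp[OF const_poly_hom assms])
  fix p
  show "poly_ext (\<lambda>c. H [:c:]) (H [:0, 1:]) p = H p"
  proof (induction p)
    case (pCons a p)
    have "H (pCons a p) = H ([:a:] + [:0, 1:] * p)"
      by simp
    with pCons show ?case
      by (simp only: H.hom_simps c.poly_ext_pCons)
  qed (simp add: H.hom_zero)
qed

section \<open>Extension to fraction fields\<close>

lemma to_fract_hom: "unital_hom (\<lambda>p::'a::idom. Fract p 1)"
  by unfold_locales (simp_all add: One_fract_def)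

text \<open>The \<open>THE\<close> is well defined because \<open>ev\<close> transports the
  cross-multiplied equality of two representations, and denominators with nonzero image can be
  divided out. Working with one denominator at a time also evaluates substitutions whose injectivity
  has not been established.\<close>

lemma frac_ext_Fract:
  assumes "unital_hom ev" "r \<noteq> 0" "ev r \<noteq> 0"
  shows "frac_ext ev (Fract p r) = ev p / ev r"
proof -
  interpret unital_hom ev by fact
  show ?thesis
    unfolding frac_ext_def
  proof (rule the_equality)
    show "\<exists>p' r'. r' \<noteq> 0 \<and> ev r' \<noteq> 0 \<and> Fract p r = Fract p' r' \<and> ev p / ev r = ev p' / ev r'"
      using assms by blast
    fix y
    assume "\<exists>p' r'. r' \<noteq> 0 \<and> ev r' \<noteq> 0 \<and> Fract p r = Fract p' r' \<and> y = ev p' / ev r'"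
    then obtain p' r' where *: "r' \<noteq> 0" "ev r' \<noteq> 0" "Fract p r = Fract p' r'" "y = ev p' / ev r'"
      by blast
    then have "p * r' = p' * r"
      using assms by (simp add: eq_fract)
    then have "ev p * ev r' = ev p' * ev r"
      by (metis hom_mult)
    then show "y = ev p / ev r"
      using * assms by (simp add: frac_eq_eq)
  qed
qed

lemma frac_ext_to_fract:
  assumes "unital_hom ev"
  shows "frac_ext ev (Fract p 1) = ev p"
  using frac_ext_Fract[OF assms, of 1 p] unital_hom.hom_one[OF assms] by simp

lemma frac_ext_hom:
  assumes "unital_hom ev" and inj: "\<And>p. ev p = 0 \<Longrightarrow> p = 0"
  shows "field_hom (frac_ext ev)"
proof
  interpret unital_hom ev by fact
  have F: "frac_ext ev (Fract p r) = ev p / ev r" if "r \<noteq> 0" for p r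
    using that inj by (auto intro!: frac_ext_Fract assms(1))
  have nz: "ev r \<noteq> 0" if "r \<noteq> 0" for r
    using that inj by blast
  show "frac_ext ev 1 = 1"
    using frac_ext_to_fract[OF assms(1), of 1] by (simp add: One_fract_def hom_one)
  fix x y :: "'a fract"
  obtain p r where x: "x = Fract p r" "r \<noteq> 0"
    by (cases x) auto
  obtain p' r' where y: "y = Fract p' r'" "r' \<noteq> 0"
    by (cases y) auto
  show "frac_ext ev (x + y) = frac_ext ev x + frac_ext ev y"
    using x y nz by (simp add: F hom_simps field_simps)
  show "frac_ext ev (x * y) = frac_ext ev x * frac_ext ev y"
    using x y nz by (simp add: F hom_simps)
qed


section \<open>Substitutions in the parameters\<close>

text \<open>The map underlying \<open>psubst\<close> before passing to fractions. The general
  coefficient map allows a target that is only a ring, in particular the polynomial ring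
  itself.\<close>

definition psub ::
  "(rat \<Rightarrow> 'b::comm_ring_1) \<Rightarrow> 'b \<Rightarrow> 'b \<Rightarrow> 'b \<Rightarrow> 'b \<Rightarrow> 'b \<Rightarrow> rat poly poly poly poly poly \<Rightarrow> 'b" where
  "psub \<phi> x1 x2 x3 x4 x5 =
     poly_ext (poly_ext (poly_ext (poly_ext (poly_ext \<phi> x1) x2) x3) x4) x5"

lemma psub_hom:
  assumes "unital_hom \<phi>"
  shows "unital_hom (psub \<phi> x1 x2 x3 x4 x5)"
  unfolding psub_def by (intro unital_hom.poly_ext_hom assms)

lemma hom_psub:
  assumes "unital_hom \<phi>" "unital_hom \<psi>"
  shows "\<psi> (psub \<phi> x1 x2 x3 x4 x5 p) =
    psub (\<lambda>c. \<psi> (\<phi> c)) (\<psi> x1) (\<psi> x2) (\<psi> x3) (\<psi> x4) (\<psi> x5) p"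
  unfolding psub_def
  by (simp add: hom_poly_ext assms unital_hom.poly_ext_hom unital_hom_comp cong: if_cong)

lemma psub_generators:
  assumes "unital_hom \<phi>"
  shows "psub \<phi> x1 x2 x3 x4 x5 [:[:[:[:[:0, 1:]:]:]:]:] = x1"
    "psub \<phi> x1 x2 x3 x4 x5 [:[:[:[:0, 1:]:]:]:] = x2"
    "psub \<phi> x1 x2 x3 x4 x5 [:[:[:0, 1:]:]:] = x3"
    "psub \<phi> x1 x2 x3 x4 x5 [:[:0, 1:]:] = x4"
    "psub \<phi> x1 x2 x3 x4 x5 [:0, 1:] = x5"
proof -
  note h1 = unital_hom.poly_ext_hom[OF assms, of x1]
  note h2 = unital_hom.poly_ext_hom[OF h1, of x2]
  note h3 = unital_hom.poly_ext_hom[OF h2, of x3]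
  note h4 = unital_hom.poly_ext_hom[OF h3, of x4]
  note s = unital_hom.poly_ext_pCons[OF assms] unital_hom.poly_ext_pCons[OF h1]
    unital_hom.poly_ext_pCons[OF h2] unital_hom.poly_ext_pCons[OF h3]
    unital_hom.poly_ext_pCons[OF h4] unital_hom.hom_one[OF assms] unital_hom.hom_one[OF h1]
    unital_hom.hom_one[OF h2] unital_hom.hom_one[OF h3] unital_hom.hom_one[OF h4]
    unital_hom.hom_zero[OF assms]
  show "psub \<phi> x1 x2 x3 x4 x5 [:[:[:[:[:0, 1:]:]:]:]:] = x1"
    "psub \<phi> x1 x2 x3 x4 x5 [:[:[:[:0, 1:]:]:]:] = x2"
    "psub \<phi> x1 x2 x3 x4 x5 [:[:[:0, 1:]:]:] = x3"
    "psub \<phi> x1 x2 x3 x4 x5 [:[:0, 1:]:] = x4"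
    "psub \<phi> x1 x2 x3 x4 x5 [:0, 1:] = x5"
    unfolding psub_def by (simp_all add: s)
qed

text \<open>The levels are absorbed from the inside out: \<open>of_rat\<close> is the embedding of
  constants, and uniqueness of the substitution then removes one variable at a time.\<close>

lemma psub_identity: "psub of_rat sqrt_mab par_b sqrt_mcd par_d sqrt_q = (\<lambda>p. Fract p 1)"
proof -
  note h5 = to_fract_hom[where 'a = "rat poly poly poly poly poly"]
  note h4 = unital_hom_comp[OF const_poly_hom h5]
  note h3 = unital_hom_comp[OF const_poly_hom h4]
  note h2 = unital_hom_comp[OF const_poly_hom h3]
  note h1 = unital_hom_comp[OF const_poly_hom h2]
  note h0 = unital_hom_comp[OF const_poly_hom h1]
  show ?thesis
    unfolding psub_def sqrt_mab_def par_b_def sqrt_mcd_def par_d_def sqrt_q_def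
      rat_hom_unique[OF h0, symmetric] poly_ext_unique[OF h1] poly_ext_unique[OF h2]
      poly_ext_unique[OF h3] poly_ext_unique[OF h4] poly_ext_unique[OF h5] ..
qed

lemma psubst_psub: "psubst x1 x2 x3 x4 x5 = frac_ext (psub of_rat x1 x2 x3 x4 x5)"
  unfolding psubst_def psub_def ..

lemma generators_nonzero [simp]:
  "sqrt_mab \<noteq> 0" "par_b \<noteq> 0" "sqrt_mcd \<noteq> 0" "par_d \<noteq> 0" "sqrt_q \<noteq> 0"
  by (simp_all add: sqrt_mab_def par_b_def sqrt_mcd_def par_d_def sqrt_q_def
      Zero_fract_def eq_fract)

lemma Fract_1_eq_0_iff: "Fract p 1 = 0 \<longleftrightarrow> p = 0"
  by (simp add: Zero_fract_def eq_fract)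

text \<open>The substitution takes values in the polynomials, where dividing by the same powers
  of \<open>sqrt_q\<close> is a left inverse.\<close>

lemma psub_scaled_inj:
  assumes "psub of_rat (sqrt_q ^ m * sqrt_mab) (sqrt_q ^ n * par_b) (sqrt_q ^ m' * sqrt_mcd)
      (sqrt_q ^ n' * par_d) sqrt_q p = 0"
  shows "p = 0"
proof -
  note h5 = to_fract_hom[where 'a = "rat poly poly poly poly poly"]
  interpret F: unital_hom "\<lambda>p::rat poly poly poly poly poly. Fract p 1" by (rule h5)
  define C where "C = (\<lambda>r::rat. [:[:[:[:[:r:]:]:]:]:])"
  have C: "unital_hom C"
    unfolding C_def by unfold_locales (simp_all add: one_pCons)
  define X where "X = ([:0, 1:] :: rat poly poly poly poly poly)"
  define \<sigma> where "\<sigma> = psub C (X ^ m * [:[:[:[:[:0, 1:]:]:]:]:]) (X ^ n * [:[:[:[:0, 1:]:]:]:])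
      (X ^ m' * [:[:[:0, 1:]:]:]) (X ^ n' * [:[:0, 1:]:]) X"
  define \<tau> where "\<tau> = psub of_rat (sqrt_mab / sqrt_q ^ m) (par_b / sqrt_q ^ n)
      (sqrt_mcd / sqrt_q ^ m') (par_d / sqrt_q ^ n') sqrt_q"
  have \<tau>: "unital_hom \<tau>"
    unfolding \<tau>_def by (rule psub_hom[OF of_rat_hom])
  interpret T: unital_hom \<tau> by fact
  note gens = sqrt_mab_def par_b_def sqrt_mcd_def par_d_def sqrt_q_def X_def
  \<comment> \<open>The vanishing substitution is \<sigma> followed by the embedding into fractions.
    So \<sigma> p vanishes as a polynomial, and \<tau>, which is defined on polynomials, can be
    applied to it.\<close>
  have "Fract (\<sigma> p) 1 = psub of_rat (sqrt_q ^ m * sqrt_mab) (sqrt_q ^ n * par_b)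
      (sqrt_q ^ m' * sqrt_mcd) (sqrt_q ^ n' * par_d) sqrt_q p"
    unfolding \<sigma>_def hom_psub[OF C h5] rat_hom_unique[OF unital_hom_comp[OF C h5]]
      F.hom_mult F.hom_power gens ..
  then have "\<sigma> p = 0"
    using assms by (simp add: Fract_1_eq_0_iff)
  then have "0 = \<tau> (\<sigma> p)"
    by (simp add: T.hom_zero)
  also have "\<dots> = psub of_rat sqrt_mab par_b sqrt_mcd par_d sqrt_q p"
    unfolding \<sigma>_def hom_psub[OF C \<tau>] rat_hom_unique[OF unital_hom_comp[OF C \<tau>]]
      T.hom_mult T.hom_power
    unfolding \<tau>_def X_def psub_generators[OF of_rat_hom]
    by simp
  also have "\<dots> = Fract p 1"
    by (simp add: psub_identity)
  finally show ?thesis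
    by (simp add: Fract_1_eq_0_iff)
qed

lemma psubst_generators:
  "psubst x1 x2 x3 x4 x5 sqrt_mab = x1"
  "psubst x1 x2 x3 x4 x5 par_b = x2"
  "psubst x1 x2 x3 x4 x5 sqrt_mcd = x3"
  "psubst x1 x2 x3 x4 x5 par_d = x4"
  "psubst x1 x2 x3 x4 x5 sqrt_q = x5"
  by (simp_all add: psubst_psub sqrt_mab_def par_b_def sqrt_mcd_def par_d_def sqrt_q_def
      frac_ext_to_fract psub_hom of_rat_hom psub_generators)

text \<open>One fraction with denominator \<open>par_b\<close> represents \<open>par_a\<close>, and
  the hypothesis says that this denominator has nonzero image.\<close>

lemma psubst_par_a:
  assumes "x2 \<noteq> 0"
  shows "psubst x1 x2 x3 x4 x5 par_a = - (x1 ^ 2) / x2"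
proof -
  let ?S = "[:[:[:[:[:0, 1:]:]:]:]:] :: rat poly poly poly poly poly"
  let ?B = "[:[:[:[:0, 1:]:]:]:] :: rat poly poly poly poly poly"
  interpret unital_hom "psub of_rat x1 x2 x3 x4 x5" by (rule psub_hom[OF of_rat_hom])
  have a: "par_a = Fract (- (?S * ?S)) ?B"
    unfolding par_a_def sqrt_mab_def par_b_def power2_eq_square mult_fract minus_fract divide_fract
    by simp
  have "psub of_rat x1 x2 x3 x4 x5 ?B \<noteq> 0"
    using assms by (simp only: psub_generators[OF of_rat_hom] not_False_eq_True)
  then have "frac_ext (psub of_rat x1 x2 x3 x4 x5) par_a =
      psub of_rat x1 x2 x3 x4 x5 (- (?S * ?S)) / psub of_rat x1 x2 x3 x4 x5 ?B"
    unfolding a by (intro frac_ext_Fract unital_hom_axioms) simp_all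
  then show ?thesis
    by (simp only: psubst_psub hom_minus hom_mult psub_generators[OF of_rat_hom] power2_eq_square)
qed

section \<open>The parameter shifts and genericity of the parameters\<close>

lemma qpow_nonzero [simp]: "qpow r \<noteq> 0"
  by (simp add: qpow_def)

lemma pshift_par_b:
  fixes h :: "rat ^ 4"
  shows "pshift h par_b = qpow (h $ 2) * par_b"
  by (simp add: pshift_def psubst_generators)

lemma pshift_par_a:
  fixes h :: "rat ^ 4"
  assumes "h \<in> shifts"
  shows "pshift h par_a = qpow (h $ 1) * par_a"
proof -
  \<comment> \<open>Membership in \<open>shifts\<close> makes the doubled exponents integers, so the
    floors in \<open>qpow\<close> are exact and q^h1 = q^(h1+h2) / q^h2 holds literally.\<close>
  obtain m n where mn: "h $ 1 + h $ 2 = of_int m" "2 * h $ 2 = of_int n"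
    using assms unfolding shifts_def by (auto elim!: Ints_cases)
  then have "2 * h $ 1 = of_int (2 * m - n)"
    by (simp add: algebra_simps)
  then have "qpow (h $ 1) = sqrt_q powi (2 * m - n)"
    unfolding qpow_def by (metis floor_of_int)
  also have "\<dots> = (sqrt_q powi m) ^ 2 / sqrt_q powi n"
    by (metis generators_nonzero(5) mult.commute power_int_diff power_int_mult power_int_numeral)
  finally have q1: "qpow (h $ 1) = (sqrt_q powi m) ^ 2 / sqrt_q powi n" .
  have "pshift h par_a =
      - ((qpow ((h $ 1 + h $ 2) / 2) * sqrt_mab) ^ 2) / (qpow (h $ 2) * par_b)"
    unfolding pshift_def by (rule psubst_par_a) simp
  also have "qpow ((h $ 1 + h $ 2) / 2) = sqrt_q powi m"
    by (simp add: qpow_def mn(1))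
  also have "qpow (h $ 2) = sqrt_q powi n"
    by (simp add: qpow_def mn(2))
  finally show ?thesis
    by (simp add: q1 par_a_def power_mult_distrib)
qed

text \<open>With nonnegative integral exponents of \<open>sqrt_q\<close> the substitution is
  polynomial, so \<open>psub_scaled_inj\<close> gives the injectivity that an extension to fractions
  needs. This covers the shifts by the first two basis vectors, through which the Steinberg
  construction changes X.\<close>

lemma pshift_hom:
  fixes h :: "rat ^ 4"
  assumes "h $ 1 + h $ 2 = of_nat m" "2 * h $ 2 = of_nat n"
    "h $ 3 + h $ 4 = of_nat m'" "2 * h $ 4 = of_nat n'"
  shows "field_hom (pshift h)"
proof -
  have "qpow ((h $ 1 + h $ 2) / 2) = sqrt_q ^ m" "qpow (h $ 2) = sqrt_q ^ n"
    "qpow ((h $ 3 + h $ 4) / 2) = sqrt_q ^ m'" "qpow (h $ 4) = sqrt_q ^ n'"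
    using assms by (simp_all add: qpow_def)
  then show ?thesis
    unfolding pshift_def psubst_psub
    by (auto intro!: frac_ext_hom psub_hom of_rat_hom intro: psub_scaled_inj)
qed

lemma axis_4_components:
  "axis 1 (1::rat) $ (1::4) = 1" "axis 1 (1::rat) $ (2::4) = 0"
  "axis 1 (1::rat) $ (3::4) = 0" "axis 1 (1::rat) $ (4::4) = 0"
  "axis 2 (1::rat) $ (1::4) = 0" "axis 2 (1::rat) $ (2::4) = 1"
  "axis 2 (1::rat) $ (3::4) = 0" "axis 2 (1::rat) $ (4::4) = 0"
  by (simp_all add: axis_def)

lemma axis_in_shifts: "axis 1 1 \<in> shifts" "axis 2 1 \<in> shifts"
  by (simp_all add: shifts_def axis_4_components)

lemma pshift_a_hom: "field_hom (pshift (axis 1 1))"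
  by (rule pshift_hom[of _ 1 0 0 0]) (simp_all add: axis_4_components)

lemma pshift_b_hom: "field_hom (pshift (axis 2 1))"
  by (rule pshift_hom[of _ 1 2 0 0]) (simp_all add: axis_4_components)

lemma pshift_a_values:
  "pshift (axis 1 1) par_a = sqrt_q ^ 2 * par_a"
  "pshift (axis 1 1) par_b = par_b"
  "pshift (axis 1 1) par_c = par_c"
  "pshift (axis 1 1) par_d = par_d"
  "pshift (axis 1 1) sqrt_q = sqrt_q"
proof -
  interpret field_hom "pshift (axis 1 1)" by (rule pshift_a_hom)
  show "pshift (axis 1 1) par_a = sqrt_q ^ 2 * par_a"
    by (simp add: pshift_par_a axis_in_shifts axis_4_components qpow_def)
  show "pshift (axis 1 1) par_b = par_b"
    "pshift (axis 1 1) par_d = par_d"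
    "pshift (axis 1 1) sqrt_q = sqrt_q"
    by (simp_all add: pshift_def psubst_generators axis_4_components qpow_def)
  then show "pshift (axis 1 1) par_c = par_c"
    unfolding par_c_def hom_divide hom_minus hom_power
    by (simp add: pshift_def psubst_generators axis_4_components qpow_def)
qed

lemma pshift_b_values:
  "pshift (axis 2 1) par_a = par_a"
  "pshift (axis 2 1) par_b = sqrt_q ^ 2 * par_b"
  "pshift (axis 2 1) par_c = par_c"
  "pshift (axis 2 1) par_d = par_d"
  "pshift (axis 2 1) sqrt_q = sqrt_q"
proof -
  interpret field_hom "pshift (axis 2 1)" by (rule pshift_b_hom)
  show "pshift (axis 2 1) par_a = par_a"
    by (simp add: pshift_par_a axis_in_shifts axis_4_components qpow_def)
  show "pshift (axis 2 1) par_b = sqrt_q ^ 2 * par_b"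
    "pshift (axis 2 1) par_d = par_d"
    "pshift (axis 2 1) sqrt_q = sqrt_q"
    by (simp_all add: pshift_def psubst_generators axis_4_components qpow_def)
  then show "pshift (axis 2 1) par_c = par_c"
    unfolding par_c_def hom_divide hom_minus hom_power
    by (simp add: pshift_def psubst_generators axis_4_components qpow_def)
qed

text \<open>Here a \<noteq> b makes \<open>V\<close> invertible, ab \<noteq> 1 makes the Koornwinder
  coordinates unique, and cd \<noteq> q and q \<noteq> 1 keep the two counterexamples from
  vanishing. The products ab and cd are polynomials in the generators, which reduces most claims to
  comparing polynomials.\<close>

lemma parameters_generic:
  "par_a \<noteq> 0" "par_a \<noteq> par_b" "par_a * par_b \<noteq> 1" "par_c * par_d \<noteq> sqrt_q ^ 2" "sqrt_q ^ 2 \<noteq> 1"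
proof -
  show "par_a \<noteq> 0"
    by (simp add: par_a_def)
  have ab: "par_a * par_b = - (sqrt_mab ^ 2)" "par_c * par_d = - (sqrt_mcd ^ 2)"
    by (simp_all add: par_a_def par_c_def)
  show "par_a * par_b \<noteq> 1" "par_c * par_d \<noteq> sqrt_q ^ 2"
    unfolding ab
    by (simp_all add: sqrt_mab_def sqrt_mcd_def sqrt_q_def power2_eq_square One_fract_def eq_fract one_pCons)
  show "sqrt_q ^ 2 \<noteq> 1"
    by (simp_all add: sqrt_q_def power2_eq_square One_fract_def eq_fract one_pCons)
  \<comment> \<open>If a = b, then ab = b^2, although ab is the negative square of a different
    indeterminate.\<close>
  have "- (sqrt_mab ^ 2) \<noteq> par_b ^ 2"
    by (simp add: sqrt_mab_def par_b_def power2_eq_square eq_fract)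
  then show "par_a \<noteq> par_b"
    using ab(1) by (auto simp: power2_eq_square)
qed


section \<open>Substitutions in rational functions of z\<close>

lemma const_eq: "const = (\<lambda>c. Fract [:c:] 1)"
  by (simp add: const_def fun_eq_iff)

lemma const_hom: "field_hom const"
  unfolding const_eq
  by (intro field_hom.intro unital_hom_comp[OF const_poly_hom to_fract_hom])

interpretation const: field_hom const
  by (rule const_hom)

lemma zvar_nonzero [simp]: "zvar \<noteq> 0"
  by (simp add: zvar_def Fract_1_eq_0_iff)

lemma zvar_square_not_1: "zvar ^ 2 \<noteq> 1"
  unfolding zvar_def One_fract_def[where 'a = "pfield poly"]
  by (simp add: power2_eq_square eq_fract one_pCons)

lemma zvar_neq_inverse [simp]: "zvar \<noteq> inverse zvar" "inverse zvar \<noteq> zvar"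
  using zvar_square_not_1 by (auto simp: field_simps power2_eq_square)

lemma zsubst_Fract_1:
  assumes "unital_hom \<phi>"
  shows "zsubst \<phi> w (Fract p 1) = poly_ext \<phi> w p"
  unfolding zsubst_def
  by (rule frac_ext_to_fract[OF unital_hom.poly_ext_hom[OF assms]])

lemma zsubst_const:
  assumes "unital_hom \<phi>"
  shows "zsubst \<phi> w (const c) = \<phi> c"
  using assms by (simp add: const_def zsubst_Fract_1 unital_hom.poly_ext_pCons)

lemma zsubst_zvar:
  assumes "unital_hom \<phi>"
  shows "zsubst \<phi> w zvar = w"
  using assms by (simp add: zvar_def zsubst_Fract_1 unital_hom.poly_ext_pCons
      unital_hom.hom_zero unital_hom.hom_one)

lemma zsubst_hom:
  assumes "unital_hom \<phi>" "\<And>p. poly_ext \<phi> w p = 0 \<Longrightarrow> p = 0"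
  shows "field_hom (zsubst \<phi> w)"
  unfolding zsubst_def by (intro frac_ext_hom unital_hom.poly_ext_hom assms)

lemma poly_ext_const_zvar: "poly_ext const zvar p = Fract p 1"
  using fun_cong[OF poly_ext_unique[OF to_fract_hom], of p]
  by (simp add: const_eq zvar_def)

text \<open>On polynomials this is composition with a polynomial of degree 1, which is
  injective.\<close>

lemma T_pow_hom: "field_hom (T_pow n)"
proof -
  let ?q = "[:0, sqrt_q powi n:]"
  have H: "unital_hom (\<lambda>p. Fract (pcompose p ?q) 1)"
    by unfold_locales
      (simp_all add: pcompose_add pcompose_mult pcompose_1 One_fract_def[where 'a = "pfield poly"])
  have "poly_ext const (const (sqrt_q powi n) * zvar) p = Fract (pcompose p ?q) 1" for p
    using fun_cong[OF poly_ext_unique[OF H], of p]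
    by (simp add: const_eq zvar_def pcompose_pCons)
  then show ?thesis
    unfolding T_pow_def
    by (intro zsubst_hom const.unital_hom_axioms)
      (simp add: Fract_1_eq_0_iff pcompose_eq_0)
qed

lemma T_pow_const [simp]: "T_pow n (const c) = const c"
  by (simp add: T_pow_def zsubst_const const.unital_hom_axioms)

lemma T_pow_zvar [simp]: "T_pow n zvar = const (sqrt_q powi n) * zvar"
  by (simp add: T_pow_def zsubst_zvar const.unital_hom_axioms)

text \<open>The involution \<iota>, taken on all of K(z) so that quotients by
  \<open>zvar - inverse zvar\<close> can be reflected too.\<close>

definition zinv :: "zfield \<Rightarrow> zfield" where
  "zinv = zsubst const (inverse zvar)"

text \<open>A polynomial that vanishes at z^-1 has a reversed polynomial that vanishes at z; as z is
  transcendental over K, the reversed polynomial is 0, and so is the original.\<close>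

lemma zinv_hom: "field_hom zinv"
  unfolding zinv_def
proof (intro zsubst_hom const.unital_hom_axioms)
  fix p
  assume "poly_ext const (inverse zvar) p = 0"
  then have "poly (map_poly const p) (inverse zvar) = 0"
    by (simp add: poly_ext_def)
  then have "poly (reflect_poly (map_poly const p)) zvar = 0"
    by (simp add: poly_reflect_poly_nz)
  moreover have "reflect_poly (map_poly const p) = map_poly const (reflect_poly p)"
    by (simp add: poly_eq_iff coeff_reflect_poly coeff_map_poly const.hom_zero
        degree_map_poly const.hom_eq_0_iff)
  ultimately have "poly_ext const zvar (reflect_poly p) = 0"
    by (simp add: poly_ext_def)
  then show "p = 0"
    by (simp add: poly_ext_const_zvar Fract_1_eq_0_iff)
qed

interpretation zinv: field_hom zinv
  by (rule zinv_hom)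

lemma zinv_const [simp]: "zinv (const c) = const c"
  by (simp add: zinv_def zsubst_const const.unital_hom_axioms)

lemma zinv_zvar [simp]: "zinv zvar = inverse zvar"
  by (simp add: zinv_def zsubst_zvar const.unital_hom_axioms)

text \<open>The substitution fixes z and applies an injective map to the coefficients, so no nonzero
  polynomial is sent to 0.\<close>

lemma zshift_hom:
  assumes "field_hom (pshift h)"
  shows "field_hom (zshift h)"
proof -
  interpret field_hom "pshift h" by fact
  have "unital_hom (\<lambda>c. const (pshift h c))"
    by (rule unital_hom_comp[OF unital_hom_axioms const.unital_hom_axioms])
  moreover have "poly_ext (\<lambda>c. const (pshift h c)) zvar p = poly_ext const zvar (map_poly (pshift h) p)" for p
    by (simp add: poly_ext_def map_poly_map_poly o_def hom_zero const.hom_zero)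
  ultimately show ?thesis
    unfolding zshift_def
    by (intro zsubst_hom)
      (auto simp: poly_ext_const_zvar Fract_1_eq_0_iff map_poly_eq_0_iff hom_eq_0_iff)
qed

lemma zshift_const:
  assumes "field_hom (pshift h)"
  shows "zshift h (const c) = const (pshift h c)"
  using assms unfolding zshift_def
  by (intro zsubst_const) (simp add: unital_hom_comp const.unital_hom_axioms field_hom.axioms)

lemma zshift_zvar:
  assumes "field_hom (pshift h)"
  shows "zshift h zvar = zvar"
  using assms unfolding zshift_def
  by (intro zsubst_zvar) (simp add: unital_hom_comp const.unital_hom_axioms field_hom.axioms)

section \<open>Expansion at infinity as a field homomorphism\<close>

lemma fls_const_hom: "unital_hom (fls_const :: pfield \<Rightarrow> pfield fls)"
  by unfold_locales (simp_all add: fls_plus_const fls_const_mult_const)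

lemma expand_inf_hom: "field_hom expand_inf"
proof -
  \<comment> \<open>The series variable is z^-1, so the coefficient of z^n sits at index -n. Every
    coefficient can thus be read off, which gives injectivity.\<close>
  have "fls_nth (poly_ext fls_const fls_X_inv p) k = (if k \<le> 0 then coeff p (nat (- k)) else 0)"
    for p :: "pfield poly" and k
  proof (induction p arbitrary: k)
    case (pCons a p)
    have "fls_nth (poly_ext fls_const fls_X_inv (pCons a p)) k =
        (if k = 0 then a else 0) + fls_nth (poly_ext fls_const fls_X_inv p) (k + 1)"
      by (simp add: unital_hom.poly_ext_pCons[OF fls_const_hom] fls_X_inv_times_conv_shift)
    also have "\<dots> = (if k \<le> 0 then coeff (pCons a p) (nat (- k)) else 0)"
    proof (cases "k < 0")
      case True
      then have "nat (- k) = Suc (nat (- (k + 1)))"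
        by simp
      with True show ?thesis
        by (simp add: pCons.IH)
    qed (auto simp: pCons.IH)
    finally show ?case .
  qed simp
  then have "coeff p n = fls_nth (poly_ext fls_const fls_X_inv p) (- int n)" for p :: "pfield poly" and n
    by simp
  then show ?thesis
    unfolding expand_inf_def
    by (intro zsubst_hom fls_const_hom) (simp add: poly_eq_iff)
qed

section \<open>Laurent polynomials\<close>

lemma to_zfield_sum:
  assumes "finite S" "Poly_Mapping.keys f \<subseteq> S"
  shows "to_zfield f = (\<Sum>n\<in>S. const (Poly_Mapping.lookup f n) * zvar powi n)"
  unfolding to_zfield_def using assms
  by (intro sum.mono_neutral_left) (auto simp: in_keys_iff const.hom_zero)

lemma to_zfield_add: "to_zfield (f + g) = to_zfield f + to_zfield g"
proof -
  let ?S = "Poly_Mapping.keys f \<union> Poly_Mapping.keys g"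
  have "to_zfield h = (\<Sum>n\<in>?S. const (Poly_Mapping.lookup h n) * zvar powi n)"
    if "h \<in> {f, g, f + g}" for h
    using that keys_add[of f g] by (intro to_zfield_sum) auto
  then show ?thesis
    by (simp add: lookup_add const.hom_add distrib_right sum.distrib)
qed

lemma to_zfield_single: "to_zfield (Poly_Mapping.single n c) = const c * zvar powi n"
  by (subst to_zfield_sum[of "{n}"]) auto

lemma to_zfield_scale: "to_zfield (Poly_Mapping.map ((*) c) f) = const c * to_zfield f"
proof -
  have "Poly_Mapping.keys (Poly_Mapping.map ((*) c) f) \<subseteq> Poly_Mapping.keys f"
    by (auto simp: in_keys_iff map.rep_eq when_def)
  then have "to_zfield (Poly_Mapping.map ((*) c) f) = (\<Sum>n\<in>Poly_Mapping.keys f.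
      const (Poly_Mapping.lookup (Poly_Mapping.map ((*) c) f) n) * zvar powi n)"
    by (intro to_zfield_sum) auto
  also have "\<dots> = (\<Sum>n\<in>Poly_Mapping.keys f. const c * (const (Poly_Mapping.lookup f n) * zvar powi n))"
    by (intro sum.cong) (auto simp: map.rep_eq in_keys_iff const.hom_mult mult.assoc)
  finally show ?thesis
    by (simp add: to_zfield_def sum_distrib_left)
qed

lemma to_zfield_reflect: "to_zfield (Poly_Mapping.map_key uminus f) = zinv (to_zfield f)"
proof -
  have lk: "Poly_Mapping.lookup (Poly_Mapping.map_key uminus f) n = Poly_Mapping.lookup f (- n)" for n
    by (simp add: map_key.rep_eq)
  have "to_zfield (Poly_Mapping.map_key uminus f) =
      (\<Sum>n\<in>uminus ` Poly_Mapping.keys f. const (Poly_Mapping.lookup f (- n)) * zvar powi n)"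
    by (subst to_zfield_sum[of "uminus ` Poly_Mapping.keys f"])
      (force simp: lk in_keys_iff)+
  also have "\<dots> = (\<Sum>n\<in>Poly_Mapping.keys f. const (Poly_Mapping.lookup f n) * zvar powi (- n))"
    by (simp add: sum.reindex)
  also have "\<dots> = zinv (to_zfield f)"
    by (simp add: to_zfield_def zinv.hom_sum zinv.field_hom_simps power_int_minus power_int_inverse)
  finally show ?thesis .
qed

text \<open>The algebra A as a subring of K(z); arguments about it run by induction over monomials
  rather than through coefficient families.\<close>

definition laurent :: "zfield set" where
  "laurent = range to_zfield"

lemma laurent_monom: "const c * zvar powi n \<in> laurent"
  unfolding laurent_def using to_zfield_single by (metis rangeI)

lemma laurent_add: "f \<in> laurent \<Longrightarrow> g \<in> laurent \<Longrightarrow> f + g \<in> laurent"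
  unfolding laurent_def using to_zfield_add by (metis (mono_tags, lifting) imageE rangeI)

lemma laurent_induct [consumes 1, case_names monom add]:
  assumes "f \<in> laurent"
    and monom: "\<And>c n. P (const c * zvar powi n)"
    and add: "\<And>g h. g \<in> laurent \<Longrightarrow> h \<in> laurent \<Longrightarrow> P g \<Longrightarrow> P h \<Longrightarrow> P (g + h)"
  shows "P f"
proof -
  obtain p where f: "f = to_zfield p"
    using assms(1) by (auto simp: laurent_def)
  let ?m = "\<lambda>n. const (Poly_Mapping.lookup p n) * zvar powi n"
  \<comment> \<open>Membership is carried along because \<open>add\<close> presupposes it. The
    default value 0 of an empty or infinite sum is a monomial with coefficient 0.\<close>
  have "sum ?m S \<in> laurent \<and> P (sum ?m S)" for S
    by (induction S rule: infinite_finite_induct)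
      (use monom[of 0] laurent_monom[of 0] in
        \<open>auto simp: const.hom_zero intro!: monom add laurent_monom laurent_add\<close>)
  then show ?thesis
    by (simp add: f to_zfield_def)
qed

lemma laurent_const [simp]: "const c \<in> laurent"
  using laurent_monom[of c 0] by simp

lemma laurent_one [simp]: "1 \<in> laurent"
  using laurent_const[of 1] by (simp add: const.hom_one)

lemma laurent_zvar [simp]: "zvar \<in> laurent"
  using laurent_monom[of 1 1] by (simp add: const.hom_one)

lemma laurent_inverse_zvar [simp]: "inverse zvar \<in> laurent"
  using laurent_monom[of 1 "-1"] by (simp add: const.hom_one power_int_minus)

lemma laurent_mult:
  assumes "f \<in> laurent" "g \<in> laurent"
  shows "f * g \<in> laurent"
  using assms(1)
proof (induction f rule: laurent_induct)
  case (monom c n)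
  from assms(2) show ?case
  proof (induction g rule: laurent_induct)
    case (monom c' n')
    have "const c * zvar powi n * (const c' * zvar powi n') = const (c * c') * zvar powi (n + n')"
      by (simp add: const.hom_mult power_int_add)
    then show ?case
      by (simp add: laurent_monom)
  qed (simp add: distrib_left laurent_add)
qed (simp add: distrib_right laurent_add)

lemma laurent_minus: "f \<in> laurent \<Longrightarrow> - f \<in> laurent"
  using laurent_mult[OF laurent_const[of "- 1"]] by (simp add: const.hom_minus const.hom_one)

lemma laurent_diff: "f \<in> laurent \<Longrightarrow> g \<in> laurent \<Longrightarrow> f - g \<in> laurent"
  using laurent_add[of f "- g"] laurent_minus[of g] by simp

lemma laurent_power: "f \<in> laurent \<Longrightarrow> f ^ n \<in> laurent"
  by (induction n) (simp_all add: laurent_mult)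

lemma laurent_prod: "(\<And>i. i \<in> A \<Longrightarrow> f i \<in> laurent) \<Longrightarrow> prod f A \<in> laurent"
  by (induction A rule: infinite_finite_induct) (simp_all add: laurent_mult)

lemma laurent_hom_image:
  assumes "field_hom \<phi>" "\<And>c. \<phi> (const c) \<in> laurent" "\<phi> zvar \<in> laurent" "\<phi> (inverse zvar) \<in> laurent"
    "f \<in> laurent"
  shows "\<phi> f \<in> laurent"
proof -
  interpret field_hom \<phi> by fact
  have "\<phi> (zvar powi n) \<in> laurent" for n
    using assms(3,4)
    by (cases "n \<ge> 0") (auto simp: power_int_def hom_power hom_inverse intro: laurent_power)
  with assms(5) show ?thesis
    by (induction f rule: laurent_induct)
      (simp_all add: hom_mult hom_add assms(2) laurent_mult laurent_add)
qed

text \<open>Constants and z generate the Laurent polynomials as a ring with z inverted, so relations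
  between \<open>zinv\<close>, \<open>T_pow\<close> and \<open>zshift\<close> need checking on z
  only.\<close>

lemma laurent_hom_eq:
  fixes \<phi> \<psi> :: "zfield \<Rightarrow> 'b::field"
  assumes "field_hom \<phi>" "field_hom \<psi>" "\<And>c. \<phi> (const c) = \<psi> (const c)" "\<phi> zvar = \<psi> zvar"
    "f \<in> laurent"
  shows "\<phi> f = \<psi> f"
proof -
  interpret p: field_hom \<phi> by fact
  interpret s: field_hom \<psi> by fact
  show ?thesis
    using assms(5)
    by (induction f rule: laurent_induct)
      (simp_all add: p.hom_mult s.hom_mult p.hom_power_int s.hom_power_int p.hom_add s.hom_add
        assms(3,4))
qed

lemma laurent_T_pow: "f \<in> laurent \<Longrightarrow> T_pow n f \<in> laurent"
proof (rule laurent_hom_image[OF T_pow_hom])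
  interpret field_hom "T_pow n" by (rule T_pow_hom)
  show "T_pow n (inverse zvar) \<in> laurent"
    by (simp add: hom_inverse laurent_mult flip: const.hom_inverse)
qed (simp_all add: laurent_mult)

lemma laurent_zshift:
  assumes "field_hom (pshift h)" "f \<in> laurent"
  shows "zshift h f \<in> laurent"
proof (rule laurent_hom_image[OF zshift_hom[OF assms(1)] _ _ _ assms(2)])
  interpret field_hom "zshift h" by (rule zshift_hom[OF assms(1)])
  show "zshift h (inverse zvar) \<in> laurent"
    by (simp add: hom_inverse zshift_zvar assms(1))
qed (simp_all add: zshift_const zshift_zvar assms(1))

lemma zinv_zinv: "f \<in> laurent \<Longrightarrow> zinv (zinv f) = f"
  using laurent_hom_eq[OF field_hom_comp[OF zinv_hom zinv_hom], of "\<lambda>x. x" f]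
  by (simp add: zinv.hom_inverse field_hom_def unital_hom_def)

lemma zinv_T_pow:
  assumes "f \<in> laurent"
  shows "zinv (T_pow n f) = T_pow (- n) (zinv f)"
proof (rule laurent_hom_eq[OF field_hom_comp[OF T_pow_hom zinv_hom]
      field_hom_comp[OF zinv_hom T_pow_hom] _ _ assms])
  interpret field_hom "T_pow (- n)" by (rule T_pow_hom)
  show "zinv (T_pow n zvar) = T_pow (- n) (zinv zvar)"
    by (simp add: zinv.hom_mult hom_inverse power_int_minus const.hom_inverse)
qed simp

lemma zinv_zshift:
  assumes "field_hom (pshift h)" "f \<in> laurent"
  shows "zinv (zshift h f) = zshift h (zinv f)"
proof (rule laurent_hom_eq[OF field_hom_comp[OF zshift_hom zinv_hom]
      field_hom_comp[OF zinv_hom zshift_hom] _ _ assms(2)])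
  interpret field_hom "zshift h" by (rule zshift_hom[OF assms(1)])
  show "zinv (zshift h zvar) = zshift h (zinv zvar)"
    by (simp add: zshift_zvar[OF assms(1)] hom_inverse)
qed (simp_all add: zshift_const assms(1))

lemma sym_lpolys_iff: "f \<in> sym_lpolys \<longleftrightarrow> f \<in> laurent \<and> zinv f = f"
proof
  assume "f \<in> sym_lpolys"
  then obtain p where p: "f = to_zfield p"
    "\<And>n. Poly_Mapping.lookup p n = Poly_Mapping.lookup p (- n)"
    by (auto simp: sym_lpolys_def)
  then have "Poly_Mapping.map_key uminus p = p"
    by (intro poly_mapping_eqI) (simp add: map_key.rep_eq flip: p(2))
  then show "f \<in> laurent \<and> zinv f = f"
    using p(1) to_zfield_reflect[of p] by (simp add: laurent_def)
next
  assume "f \<in> laurent \<and> zinv f = f"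
  then obtain p where p: "f = to_zfield p" "zinv f = f"
    by (auto simp: laurent_def)
  \<comment> \<open>The representative p is not known to be symmetric; its average with its
    reflection is, and it represents the same f because f is invariant.\<close>
  define r where "r = Poly_Mapping.map ((*) (1 / 2)) p"
  define s where "s = r + Poly_Mapping.map_key uminus r"
  have "to_zfield s = const (1 / 2) * f + const (1 / 2) * f"
    unfolding s_def to_zfield_add to_zfield_reflect r_def to_zfield_scale
    using p by (simp add: zinv.hom_mult)
  also have "\<dots> = f"
    by (simp flip: distrib_right const.hom_add add: const.hom_one)
  finally have "f = to_zfield s" ..
  moreover have "Poly_Mapping.lookup s n = Poly_Mapping.lookup s (- n)" for n
    by (simp add: s_def lookup_add map_key.rep_eq)
  ultimately show "f \<in> sym_lpolys"
    by (auto simp: sym_lpolys_def)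
qed

lemma sym_lpolys_laurent: "f \<in> sym_lpolys \<Longrightarrow> f \<in> laurent"
  by (simp add: sym_lpolys_iff)

lemma sym_lpolys_zero: "0 \<in> sym_lpolys"
  using laurent_const[of 0] by (simp add: sym_lpolys_iff const.hom_zero zinv.hom_zero)

lemma sym_lpolys_one: "1 \<in> sym_lpolys"
  by (simp add: sym_lpolys_iff zinv.hom_one)

lemma sym_lpolys_const: "const c \<in> sym_lpolys"
  by (simp add: sym_lpolys_iff)

lemma sym_lpolys_mult: "f \<in> sym_lpolys \<Longrightarrow> g \<in> sym_lpolys \<Longrightarrow> f * g \<in> sym_lpolys"
  by (simp add: sym_lpolys_iff zinv.hom_mult laurent_mult)

text \<open>By linearity it suffices to divide z^n - z^-n by z - z^-1. The quotient is symmetric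
  because numerator and denominator both change sign under \<iota>.\<close>

lemma antisym_quotient:
  assumes "f \<in> laurent"
  shows "(f - zinv f) / (zvar - inverse zvar) \<in> sym_lpolys"
proof -
  let ?s = "\<lambda>n. (zvar powi n - zvar powi (- n)) / (zvar - inverse zvar)"
  have nat: "?s (int n) \<in> laurent" for n
  proof (induction n)
    case 0
    show ?case
      using laurent_const[of 0] by (simp add: const.hom_zero)
  next
    case (Suc n)
    have "zvar powi int (Suc n) = zvar * zvar powi int n"
      "zvar powi (- int (Suc n)) = inverse zvar * zvar powi (- int n)"
      by (simp_all add: power_int_add power_int_diff power_int_minus divide_inverse)
    \<comment> \<open>This yields the recursion s(n+1) = z s(n) + z^-n for the quotients, starting
      from s(0) = 0.\<close>
    then have "zvar powi int (Suc n) - zvar powi (- int (Suc n)) =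
        zvar * (zvar powi int n - zvar powi (- int n)) + zvar powi (- int n) * (zvar - inverse zvar)"
      by (simp add: algebra_simps)
    then have "?s (int (Suc n)) = zvar * ?s (int n) + zvar powi (- int n)"
      by (simp add: add_divide_distrib)
    moreover have "zvar powi (- int n) \<in> laurent"
      using laurent_monom[of 1 "- int n"] by (simp add: const.hom_one)
    ultimately show ?case
      using Suc by (simp only: laurent_add laurent_mult laurent_zvar)
  qed
  have int: "?s n \<in> laurent" for n
  proof (cases n)
    case (neg m)
    then have "?s n = - ?s (int (Suc m))"
      by (simp only: minus_divide_left minus_diff_eq minus_minus)
    then show ?thesis
      by (simp only: laurent_minus[OF nat])
  qed (use nat in simp)
  have "(f - zinv f) / (zvar - inverse zvar) \<in> laurent"
    using assms
  proof (induction f rule: laurent_induct)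
    case (monom c n)
    have "(const c * zvar powi n - zinv (const c * zvar powi n)) / (zvar - inverse zvar) = const c * ?s n"
      by (simp add: zinv.hom_mult zinv.hom_power_int power_int_inverse power_int_minus right_diff_distrib)
    then show ?case
      by (simp only: laurent_mult laurent_const int)
  next
    case (add g h)
    have "(g + h - zinv (g + h)) / (zvar - inverse zvar) =
        (g - zinv g) / (zvar - inverse zvar) + (h - zinv h) / (zvar - inverse zvar)"
      by (simp add: zinv.hom_add flip: add_divide_distrib)
    with add show ?case
      by (simp only: laurent_add)
  qed
  moreover have "zinv ((f - zinv f) / (zvar - inverse zvar)) = (zinv f - f) / (inverse zvar - zvar)"
    using assms by (simp add: zinv.hom_divide zinv.hom_diff zinv_zinv zinv.hom_inverse)
  moreover have "\<dots> = (f - zinv f) / (zvar - inverse zvar)"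
    by (metis minus_diff_eq minus_divide_divide)
  ultimately show ?thesis
    by (simp add: sym_lpolys_iff)
qed


section \<open>Antisymmetrised q-difference operators\<close>

text \<open>The common shape of all elementary operators: g is 1 for \<open>G_plus\<close>,
  \<open>A1 zvar\<close> for \<open>G_minus\<close> and \<open>A_pair i j zvar\<close> for
  \<open>E_op i j\<close>.\<close>

definition antisym_op :: "zfield \<Rightarrow> qdiff" where
  "antisym_op g = Poly_Mapping.single 1 (g / (zvar - inverse zvar))
     - Poly_Mapping.single (- 1) (zinv g / (zvar - inverse zvar))"

lemma act_zero: "act X 0 = 0"
proof -
  have "T_pow n 0 = 0" for n
    using field_hom.axioms[OF T_pow_hom] by (rule unital_hom.hom_zero)
  then show ?thesis
    by (simp add: act_def)
qed

lemma act_const_mult: "act X (const c * f) = const c * act X f"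
proof -
  have "T_pow n (const c * f) = const c * T_pow n f" for n
    using unital_hom.hom_mult[OF field_hom.axioms[OF T_pow_hom]] by simp
  then show ?thesis
    by (simp add: act_def sum_distrib_left mult_ac)
qed

lemma lookup_antisym_op:
  "Poly_Mapping.lookup (antisym_op g) n =
    (if n = 1 then g / (zvar - inverse zvar)
     else if n = - 1 then - zinv g / (zvar - inverse zvar) else 0)"
  by (simp add: antisym_op_def lookup_minus lookup_single when_def)

lemma act_antisym_op:
  "act (antisym_op g) f = (g * T_pow 1 f - zinv g * T_pow (- 1) f) / (zvar - inverse zvar)"
proof -
  have "Poly_Mapping.keys (antisym_op g) \<subseteq> {1, - 1}"
    by (auto simp: in_keys_iff lookup_antisym_op split: if_splits)
  then have "act (antisym_op g) f =
      (\<Sum>n\<in>{1, - 1}. Poly_Mapping.lookup (antisym_op g) n * T_pow n f)"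
    unfolding act_def by (intro sum.mono_neutral_left) (auto simp: in_keys_iff)
  then show ?thesis
    by (simp add: lookup_antisym_op diff_divide_distrib)
qed

text \<open>Reflection turns T into its inverse, so on symmetric f the second term is the reflection
  of the first and \<open>antisym_quotient\<close> applies.\<close>

lemma act_antisym_op_sym:
  assumes "f \<in> sym_lpolys"
  shows "act (antisym_op g) f = (g * T_pow 1 f - zinv (g * T_pow 1 f)) / (zvar - inverse zvar)"
  using assms by (simp add: act_antisym_op zinv.hom_mult zinv_T_pow sym_lpolys_iff)

lemma act_antisym_op_in_sym_lpolys:
  assumes "g \<in> laurent" "f \<in> sym_lpolys"
  shows "act (antisym_op g) f \<in> sym_lpolys"
  unfolding act_antisym_op_sym[OF assms(2)]
  by (intro antisym_quotient laurent_mult laurent_T_pow sym_lpolys_laurent assms)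

lemma act_antisym_op_diff:
  "act (antisym_op g) f - act (antisym_op g') f = act (antisym_op (g - g')) f"
  by (simp add: act_antisym_op zinv.hom_diff left_diff_distrib flip: diff_divide_distrib)

text \<open>A parameter shift fixes z and commutes with \<iota> on Laurent polynomials, so the shape
  is preserved and only g changes.\<close>

lemma opshift_antisym_op:
  assumes "field_hom (pshift h)" "g \<in> laurent"
  shows "opshift h (antisym_op g) = antisym_op (zshift h g)"
proof (rule poly_mapping_eqI)
  fix n
  interpret field_hom "zshift h" by (rule zshift_hom[OF assms(1)])
  show "Poly_Mapping.lookup (opshift h (antisym_op g)) n =
      Poly_Mapping.lookup (antisym_op (zshift h g)) n"
    by (simp add: opshift_def map.rep_eq lookup_antisym_op field_hom_simps zshift_zvar assms
        zinv_zshift when_def)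
qed

lemma G_plus_antisym: "G_plus = antisym_op 1"
  by (simp add: G_plus_def antisym_op_def zinv.hom_one)

lemma zinv_A1: "zinv (A1 zvar) = A1 (inverse zvar)"
  by (simp add: A1_def zinv.hom_mult zinv.hom_power_int zinv.hom_prod zinv.hom_diff zinv.hom_one)

lemma G_minus_antisym: "G_minus = antisym_op (A1 zvar)"
  by (simp add: G_minus_def antisym_op_def zinv_A1)

lemma zinv_A_pair: "zinv (A_pair i j zvar) = A_pair i j (inverse zvar)"
  by (simp add: A_pair_def zinv.hom_mult zinv.hom_minus zinv.hom_inverse zinv.hom_diff zinv.hom_one)

lemma E_op_antisym: "E_op i j = antisym_op (A_pair i j zvar)"
  by (simp add: E_op_def antisym_op_def zinv_A_pair)

lemma laurent_A1: "A1 zvar \<in> laurent"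
  unfolding A1_def
  by (intro laurent_mult laurent_prod laurent_diff laurent_one laurent_const laurent_zvar)
    (use laurent_monom[of 1 "- 2"] in \<open>simp add: const.hom_one\<close>)

lemma laurent_A_pair: "A_pair i j zvar \<in> laurent"
  unfolding A_pair_def
  by (intro laurent_mult laurent_diff laurent_minus laurent_one laurent_const laurent_zvar
      laurent_inverse_zvar)


section \<open>The two constructions on symmetric Laurent polynomials\<close>

text \<open>\<open>inv_into\<close> picks some preimage in \<open>sym_pairs\<close>; existence of
  (f, 0) and uniqueness over this particular f determine the choice.\<close>

lemma inv_into_pair:
  assumes "f \<in> sym_lpolys" "B (vector [f, 0]) = f"
    and "\<And>u. u \<in> sym_pairs \<Longrightarrow> B u = f \<Longrightarrow> u $ 1 = f \<and> u $ 2 = 0"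
  shows "inv_into sym_pairs B f = vector [f, 0]"
proof -
  have "vector [f, 0] \<in> sym_pairs"
    using assms(1) sym_lpolys_zero by (simp add: sym_pairs_def forall_2)
  then have "inv_into sym_pairs B f \<in> sym_pairs" "B (inv_into sym_pairs B f) = f"
    using assms(2) by (metis image_eqI inv_into_into, metis f_inv_into_f image_eqI)
  then show ?thesis
    using assms(3) by (simp add: vec_eq_iff forall_2)
qed

lemma inv_into_B_K:
  assumes "f \<in> sym_lpolys" "a * b \<noteq> 1"
  shows "inv_into sym_pairs (B_K a b) f = vector [f, 0]"
proof (rule inv_into_pair[OF assms(1)])
  fix u
  assume u: "u \<in> sym_pairs" "B_K a b u = f"
  then have s: "zinv (u $ 1) = u $ 1" "zinv (u $ 2) = u $ 2" "zinv f = f"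
    using assms(1) by (auto simp: sym_pairs_def sym_lpolys_iff)
  let ?w = "inverse zvar * (1 - const a * zvar) * (1 - const b * zvar)"
  have f: "f = u $ 1 + ?w * u $ 2"
    using u(2) by (simp add: B_K_def)
  then have "zinv f = u $ 1 + zinv ?w * u $ 2"
    by (simp add: zinv.hom_add zinv.hom_mult s)
  \<comment> \<open>Subtracting the reflected equation leaves a multiple of the second coordinate;
    its factor is (ab - 1)(z - z^-1), which is nonzero.\<close>
  with f s(3) have "?w * u $ 2 = zinv ?w * u $ 2"
    by (metis add_left_cancel)
  then have "(?w - zinv ?w) * u $ 2 = 0"
    by (simp only: left_diff_distrib right_minus_eq)
  moreover have "?w - zinv ?w = (const (a * b) - 1) * (zvar - inverse zvar)"
    by (simp add: zinv.field_hom_simps const.hom_mult field_simps)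
  moreover have "const (a * b) - 1 \<noteq> 0"
    using assms(2) const.hom_eq_0_iff[of "a * b - 1"] by (simp add: const.hom_diff const.hom_one)
  ultimately have "u $ 2 = 0"
    by simp
  then show "u $ 1 = f \<and> u $ 2 = 0"
    using f by simp
qed (simp add: B_K_def)

text \<open>The argument for \<open>B_K\<close> with z as second basis element: here the factor is z
  - z^-1.\<close>

lemma inv_into_B_S:
  assumes "f \<in> sym_lpolys"
  shows "inv_into sym_pairs B_S f = vector [f, 0]"
proof (rule inv_into_pair[OF assms(1)])
  fix u
  assume u: "u \<in> sym_pairs" "B_S u = f"
  then have s: "zinv (u $ 1) = u $ 1" "zinv (u $ 2) = u $ 2" "zinv f = f"
    using assms(1) by (auto simp: sym_pairs_def sym_lpolys_iff)
  have f: "f = u $ 1 + zvar * u $ 2"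
    using u(2) by (simp add: B_S_def)
  then have "zinv f = u $ 1 + inverse zvar * u $ 2"
    by (simp add: zinv.hom_add zinv.hom_mult s)
  with f s(3) have "zvar * u $ 2 = inverse zvar * u $ 2"
    by (metis add_left_cancel)
  then have "u $ 2 = 0"
    by simp
  then show "u $ 1 = f \<and> u $ 2 = 0"
    using f by simp
qed (simp add: B_S_def)

text \<open>The coordinates of f are (f, 0), and the diagonal matrix preserves this shape because an
  operator sends 0 to 0.\<close>

lemma koornwinder_restricts_to:
  assumes "act X ` sym_lpolys \<subseteq> sym_lpolys"
  shows "restricts_to (koornwinder h X) (act X)"
proof -
  have "koornwinder h X f = act X f" if "f \<in> sym_lpolys" for f
    by (simp add: koornwinder_def Let_def inv_into_B_K that parameters_generic B_K_def act_zero)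
  then show ?thesis
    using assms by (auto simp: restricts_to_def restricts_def)
qed

text \<open>The second row of \<open>V\<close> forces opposite components, the first row fixes the
  scale. The determinant is the same D, nonzero because a \<noteq> b, so the solution of the linear
  system is unique.\<close>

lemma matrix_inv_V:
  assumes "a \<noteq> b" "a \<noteq> 0" "b \<noteq> 0"
  shows "matrix_inv (V a b) *v vector [f, 0] =
    vector [const (inverse (inverse b - inverse a)) * f, - const (inverse (inverse b - inverse a)) * f]"
proof -
  let ?D = "inverse b - inverse a"
  have D: "?D \<noteq> 0"
    using assms by simp
  have "det (V a b) = const ?D"
    by (simp add: det_2 V_def const.hom_diff)
  then have "invertible (V a b)"
    using D by (simp add: invertible_det_nz const.hom_eq_0_iff)
  \<comment> \<open>\<open>matrix_inv\<close> is a choice among two-sided inverses; only its being a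
    left inverse is extracted.\<close>
  then have inv: "matrix_inv (V a b) ** V a b = mat 1"
    unfolding invertible_def matrix_inv_def by (rule someI2_ex) blast
  let ?w = "vector [const (inverse ?D) * f, - const (inverse ?D) * f] :: zfield ^ 2"
  have V: "V a b *v ?w = vector [f, 0]"
  proof -
    have "const (inverse b) * (const (inverse ?D) * f) - const (inverse a) * (const (inverse ?D) * f) =
        const (?D * inverse ?D) * f"
      by (simp only: const.hom_mult const.hom_diff left_diff_distrib mult.assoc)
    also have "\<dots> = f"
      using D by (simp add: const.hom_one)
    finally show ?thesis
      by (simp add: vec_eq_iff forall_2 matrix_vector_mult_def sum_2 V_def)
  qed
  have "matrix_inv (V a b) *v (V a b *v ?w) = ?w"
    by (simp only: matrix_vector_mul_assoc inv matrix_vector_mul_lid)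
  then show ?thesis
    by (simp only: V)
qed

text \<open>The diagonal operators send D^-1 (f, -f) to D^-1 (g1, -g2) by K-linearity. The second
  row of the shifted \<open>V\<close> then produces g1 - g2, which \<open>B_S\<close> multiplies by
  z.\<close>

lemma steinberg_sym:
  fixes X :: qdiff and h :: "rat ^ 4"
  assumes "f \<in> sym_lpolys"
  defines "D \<equiv> inverse par_b - inverse par_a"
    and "g1 \<equiv> act (opshift (axis 1 1) X) f" and "g2 \<equiv> act (opshift (axis 2 1) X) f"
  shows "steinberg h X f = const (inverse D) *
    (const (inverse (pshift h par_b)) * g2 - const (inverse (pshift h par_a)) * g1 + zvar * (g1 - g2))"
proof -
  have "act Y (- const c * f) = - const c * act Y f" for Y c
    using act_const_mult[of Y "- c"] by (simp add: const.hom_minus)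
  then show ?thesis
    unfolding steinberg_def Let_def inv_into_B_S[OF assms(1)] g1_def g2_def D_def
      matrix_inv_V[OF parameters_generic(2,1) generators_nonzero(2)]
    by (simp add: act_const_mult B_S_def matrix_vector_mult_def sum_2 V_def)
      (simp add: algebra_simps)
qed

text \<open>Equal g1 and g2 remove the z-term. What remains is the ratio of the shifted D to D, and
  this is q^-h1 because h1 = h2 scales a and b alike.\<close>

lemma steinberg_restricts_to:
  fixes h :: "rat ^ 4"
  assumes "opshift (axis 1 1) X = X" "opshift (axis 2 1) X = X" "act X ` sym_lpolys \<subseteq> sym_lpolys"
    and "h \<in> shifts" "h $ 1 = h $ 2" "c = qpow (- (h $ 1))"
  shows "restricts_to (steinberg h X) (\<lambda>f. const c * act X f)"
proof -
  have "2 * h $ 2 \<in> \<int>"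
    using assms(4) by (simp add: shifts_def)
  \<comment> \<open>Negating the exponent inverts \<open>qpow\<close> only if the floor is exact; 2
    h1 is an integer since h1 = h2.\<close>
  then have c: "c = inverse (qpow (h $ 1))"
    by (auto simp: assms(5,6) qpow_def power_int_minus elim!: Ints_cases)
  have D: "inverse par_b - inverse par_a \<noteq> 0"
    using parameters_generic by simp
  have "steinberg h X f = const c * act X f" if f: "f \<in> sym_lpolys" for f
  proof -
    have "inverse (pshift h par_b) - inverse (pshift h par_a) =
        c * (inverse par_b - inverse par_a)"
      by (simp add: c pshift_par_a pshift_par_b assms(4,5) right_diff_distrib)
    then have "inverse (inverse par_b - inverse par_a) *
        (inverse (pshift h par_b) - inverse (pshift h par_a)) = c"
      using D by simp
    then show ?thesis
      unfolding steinberg_sym[OF f] assms(1,2)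
      by (simp flip: left_diff_distrib const.hom_diff const.hom_mult mult.assoc)
  qed
  then show ?thesis
    using assms(3) sym_lpolys_mult[OF sym_lpolys_const]
    by (auto simp: restricts_to_def restricts_def)
qed

text \<open>Since r is symmetric, a symmetric image would make z (u1 - u2) invariant under \<iota>,
  hence u1 = u2. Linearity in g expresses u1 - u2 through g1 - g2.\<close>

lemma steinberg_not_restricts:
  assumes "f \<in> sym_lpolys" "opshift (axis 1 1) X = antisym_op g1" "opshift (axis 2 1) X = antisym_op g2"
    and "g1 \<in> laurent" "g2 \<in> laurent" "act (antisym_op (g1 - g2)) f \<noteq> 0"
  shows "\<not> restricts (steinberg h X)"
proof
  assume "restricts (steinberg h X)"
  then have "steinberg h X f \<in> sym_lpolys"
    using assms(1) by (auto simp: restricts_def)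
  then have s: "zinv (steinberg h X f) = steinberg h X f"
    by (simp add: sym_lpolys_iff)
  define D where "D = inverse par_b - inverse par_a"
  define u1 u2 where "u1 = act (antisym_op g1) f" and "u2 = act (antisym_op g2) f"
  have u: "zinv u1 = u1" "zinv u2 = u2"
    using act_antisym_op_in_sym_lpolys assms(1,4,5) by (auto simp: u1_def u2_def sym_lpolys_iff)
  define r where "r = const (inverse (pshift h par_b)) * u2 - const (inverse (pshift h par_a)) * u1"
  have S: "steinberg h X f = const (inverse D) * (r + zvar * (u1 - u2))"
    unfolding steinberg_sym[OF assms(1)] assms(2,3) u1_def u2_def D_def r_def ..
  have "zinv r = r"
    by (simp add: r_def u zinv.hom_simps)
  then have "zinv (steinberg h X f) = const (inverse D) * (r + inverse zvar * (u1 - u2))"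
    by (simp add: S u zinv.hom_simps)
  moreover have "const (inverse D) \<noteq> 0"
    using parameters_generic by (simp add: D_def const.hom_eq_0_iff)
  ultimately have "zvar * (u1 - u2) = inverse zvar * (u1 - u2)"
    using s S by simp
  then have "u1 - u2 = 0"
    by simp
  then show False
    using assms(6) by (simp add: u1_def u2_def act_antisym_op_diff)
qed

section \<open>The elementary operators under parameter shifts\<close>

lemma vector_4 [simp]:
  "(vector [w, x, y, z] :: 'a::zero ^ 4) $ 1 = w"
  "(vector [w, x, y, z] :: 'a::zero ^ 4) $ 2 = x"
  "(vector [w, x, y, z] :: 'a::zero ^ 4) $ 3 = y"
  "(vector [w, x, y, z] :: 'a::zero ^ 4) $ 4 = z"
  unfolding vector_def by simp_all

lemma pars_nth [simp]:
  "pars $ 1 = par_a" "pars $ 2 = par_b" "pars $ 3 = par_c" "pars $ 4 = par_d"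
  by (simp_all add: pars_def)

lemma prod_4: "prod f (UNIV :: 4 set) = f 1 * f 2 * f 3 * f 4"
  unfolding UNIV_4 by (simp add: ac_simps)

lemma v_nth [simp]:
  "v1 $ 1 = 1 / 2" "v1 $ 2 = 1 / 2" "v1 $ 3 = 1 / 2" "v1 $ 4 = 1 / 2"
  "v2 $ 1 = 1 / 2" "v2 $ 2 = 1 / 2" "v2 $ 3 = - 1 / 2" "v2 $ 4 = - 1 / 2"
  "v3 $ 1 = 1 / 2" "v3 $ 2 = - 1 / 2" "v3 $ 3 = 1 / 2" "v3 $ 4 = - 1 / 2"
  "v4 $ 1 = 1 / 2" "v4 $ 2 = - 1 / 2" "v4 $ 3 = - 1 / 2" "v4 $ 4 = 1 / 2"
  by (simp_all add: v1_def v2_def v3_def v4_def)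

lemma zshift_A_pair:
  assumes "field_hom (pshift h)"
  shows "zshift h (A_pair i j zvar) = - inverse zvar * (1 - const (pshift h (pars $ i / sqrt_q)) * zvar)
    * (1 - const (pshift h (pars $ j / sqrt_q)) * zvar)"
proof -
  interpret field_hom "zshift h" by (rule zshift_hom[OF assms])
  show ?thesis
    unfolding A_pair_def hom_mult hom_minus hom_diff hom_inverse hom_one
    by (simp only: zshift_const[OF assms] zshift_zvar[OF assms])
qed

lemma zshift_A1:
  assumes "field_hom (pshift h)"
  shows "zshift h (A1 zvar) = const (pshift h (inverse sqrt_q)) * zvar powi (- 2) *
    (\<Prod>i\<in>UNIV. 1 - const (pshift h (pars $ i / sqrt_q)) * zvar)"
proof -
  interpret field_hom "zshift h" by (rule zshift_hom[OF assms])
  show ?thesis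
    unfolding A1_def hom_mult hom_prod hom_diff hom_power_int hom_one
    by (simp only: zshift_const[OF assms] zshift_zvar[OF assms])
qed

lemma pshift_quotients:
  "pshift (axis 1 1) (par_a / sqrt_q) = sqrt_q ^ 2 * (par_a / sqrt_q)"
  "pshift (axis 1 1) (par_b / sqrt_q) = par_b / sqrt_q"
  "pshift (axis 1 1) (par_c / sqrt_q) = par_c / sqrt_q"
  "pshift (axis 1 1) (par_d / sqrt_q) = par_d / sqrt_q"
  "pshift (axis 1 1) (inverse sqrt_q) = inverse sqrt_q"
  "pshift (axis 2 1) (par_a / sqrt_q) = par_a / sqrt_q"
  "pshift (axis 2 1) (par_b / sqrt_q) = sqrt_q ^ 2 * (par_b / sqrt_q)"
  "pshift (axis 2 1) (par_c / sqrt_q) = par_c / sqrt_q"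
  "pshift (axis 2 1) (par_d / sqrt_q) = par_d / sqrt_q"
  "pshift (axis 2 1) (inverse sqrt_q) = inverse sqrt_q"
proof -
  interpret a: field_hom "pshift (axis 1 1)" by (rule pshift_a_hom)
  interpret b: field_hom "pshift (axis 2 1)" by (rule pshift_b_hom)
  show "pshift (axis 1 1) (par_a / sqrt_q) = sqrt_q ^ 2 * (par_a / sqrt_q)"
    "pshift (axis 1 1) (par_b / sqrt_q) = par_b / sqrt_q"
    "pshift (axis 1 1) (par_c / sqrt_q) = par_c / sqrt_q"
    "pshift (axis 1 1) (par_d / sqrt_q) = par_d / sqrt_q"
    "pshift (axis 1 1) (inverse sqrt_q) = inverse sqrt_q"
    by (simp_all add: a.hom_divide a.hom_inverse pshift_a_values)
  show "pshift (axis 2 1) (par_a / sqrt_q) = par_a / sqrt_q"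
    "pshift (axis 2 1) (par_b / sqrt_q) = sqrt_q ^ 2 * (par_b / sqrt_q)"
    "pshift (axis 2 1) (par_c / sqrt_q) = par_c / sqrt_q"
    "pshift (axis 2 1) (par_d / sqrt_q) = par_d / sqrt_q"
    "pshift (axis 2 1) (inverse sqrt_q) = inverse sqrt_q"
    by (simp_all add: b.hom_divide b.hom_inverse pshift_b_values)
qed

section \<open>Elementary operators: symmetry and the effect of shifting a or b\<close>

lemma act_G_plus_in_sym_lpolys: "act G_plus ` sym_lpolys \<subseteq> sym_lpolys"
  by (auto simp: G_plus_antisym intro: act_antisym_op_in_sym_lpolys)

lemma act_E_op_in_sym_lpolys: "act (E_op i j) ` sym_lpolys \<subseteq> sym_lpolys"
  by (auto simp: E_op_antisym intro: act_antisym_op_in_sym_lpolys laurent_A_pair)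

lemma opshift_G_plus:
  assumes "field_hom (pshift h)"
  shows "opshift h G_plus = G_plus"
proof -
  interpret field_hom "zshift h" by (rule zshift_hom[OF assms])
  show ?thesis
    by (simp add: G_plus_antisym opshift_antisym_op assms hom_one)
qed

lemma opshift_E_34:
  "opshift (axis 1 1) (E_op 3 4) = E_op 3 4" "opshift (axis 2 1) (E_op 3 4) = E_op 3 4"
proof -
  show "opshift (axis 1 1) (E_op 3 4) = E_op 3 4"
    unfolding E_op_antisym opshift_antisym_op[OF pshift_a_hom laurent_A_pair]
      zshift_A_pair[OF pshift_a_hom]
    by (simp add: A_pair_def pshift_quotients)
  show "opshift (axis 2 1) (E_op 3 4) = E_op 3 4"
    unfolding E_op_antisym opshift_antisym_op[OF pshift_b_hom laurent_A_pair]
      zshift_A_pair[OF pshift_b_hom]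
    by (simp add: A_pair_def pshift_quotients)
qed

text \<open>The constant by which \<open>A_pair 1 2 zvar\<close> with a shifted differs from the
  same with b shifted.\<close>

definition shift_defect :: pfield where
  "shift_defect = (sqrt_q ^ 2 - 1) * (par_a / sqrt_q - par_b / sqrt_q)"

lemma shift_defect_nonzero: "shift_defect \<noteq> 0"
  using parameters_generic by (simp add: shift_defect_def)

text \<open>Constant and quadratic terms agree on both sides of the difference, so only the linear
  term survives.\<close>

lemma defect_identity:
  fixes Q \<alpha> \<beta> z :: "'a::comm_ring_1"
  shows "(1 - Q * \<alpha> * z) * (1 - \<beta> * z) - (1 - \<alpha> * z) * (1 - Q * \<beta> * z) = - ((Q - 1) * (\<alpha> - \<beta>) * z)"
  by (simp add: algebra_simps)

lemma const_shift_defect: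
  "const shift_defect = (const (sqrt_q ^ 2) - 1) * (const (par_a / sqrt_q) - const (par_b / sqrt_q))"
  by (simp only: shift_defect_def const.hom_mult const.hom_diff const.hom_one)

text \<open>The linear term cancels the prefactor z^-1, so the two shifted operators differ by a
  constant multiple of \<open>G_plus\<close>.\<close>

lemma zshift_difference_A_12:
  "zshift (axis 1 1) (A_pair 1 2 zvar) - zshift (axis 2 1) (A_pair 1 2 zvar) = const shift_defect"
proof -
  let ?Q = "const (sqrt_q ^ 2)" and ?\<alpha> = "const (par_a / sqrt_q)" and ?\<beta> = "const (par_b / sqrt_q)"
  have common_factor: "m * x * y - m * x' * y' = m * (x * y - x' * y')" for m x y x' y' :: zfield
    by (simp add: algebra_simps)
  have "zshift (axis 1 1) (A_pair 1 2 zvar) - zshift (axis 2 1) (A_pair 1 2 zvar) =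
      - inverse zvar * ((1 - ?Q * ?\<alpha> * zvar) * (1 - ?\<beta> * zvar) - (1 - ?\<alpha> * zvar) * (1 - ?Q * ?\<beta> * zvar))"
    unfolding zshift_A_pair[OF pshift_a_hom] zshift_A_pair[OF pshift_b_hom] pars_nth
      pshift_quotients const.hom_mult
    by (rule common_factor)
  also have "\<dots> = const shift_defect"
    unfolding defect_identity const_shift_defect by (simp add: mult.commute)
  finally show ?thesis .
qed

text \<open>The factors with c and d are common, and the linear term turns z^-2 into z^-1. The two
  shifted operators therefore differ by a constant multiple of \<open>E_op 3 4\<close>.\<close>

lemma zshift_difference_A1:
  "zshift (axis 1 1) (A1 zvar) - zshift (axis 2 1) (A1 zvar) =
    const (shift_defect / sqrt_q) * A_pair 3 4 zvar"
proof -
  let ?Q = "const (sqrt_q ^ 2)" and ?\<alpha> = "const (par_a / sqrt_q)" and ?\<beta> = "const (par_b / sqrt_q)"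
    and ?R = "(1 - const (par_c / sqrt_q) * zvar) * (1 - const (par_d / sqrt_q) * zvar)"
  have common_factors: "m * (x * y * r * s) - m * (x' * y' * r * s) = m * ((x * y - x' * y') * (r * s))"
    for m x y x' y' r s :: zfield
    by (simp add: algebra_simps)
  have "zshift (axis 1 1) (A1 zvar) - zshift (axis 2 1) (A1 zvar) =
      const (inverse sqrt_q) * zvar powi (- 2) *
      (((1 - ?Q * ?\<alpha> * zvar) * (1 - ?\<beta> * zvar) - (1 - ?\<alpha> * zvar) * (1 - ?Q * ?\<beta> * zvar)) * ?R)"
    unfolding zshift_A1[OF pshift_a_hom] zshift_A1[OF pshift_b_hom] prod_4 pars_nth
      pshift_quotients const.hom_mult
    by (rule common_factors)
  also have "\<dots> = const (inverse sqrt_q) * const shift_defect * - (zvar powi (- 2) * zvar * ?R)"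
    unfolding defect_identity const_shift_defect by (simp only: mult_minus_left mult_minus_right mult_ac)
  also have "zvar powi (- 2) * zvar = inverse zvar"
    by (simp add: power_int_minus power2_eq_square)
  finally show ?thesis
    by (simp add: A_pair_def divide_inverse const.hom_mult mult_ac)
qed

lemma act_antisym_op_const_mult:
  "act (antisym_op (const c * g)) f = const c * act (antisym_op g) f"
  by (simp add: act_antisym_op zinv.hom_mult algebra_simps)

lemma act_E_34_one: "act (E_op 3 4) 1 = const (1 - par_c * par_d / sqrt_q ^ 2)"
proof -
  have "T_pow n 1 = 1" for n
    using field_hom.axioms[OF T_pow_hom] by (rule unital_hom.hom_one)
  then have "act (E_op 3 4) 1 =
      (A_pair 3 4 zvar - A_pair 3 4 (inverse zvar)) / (zvar - inverse zvar)"
    by (simp add: E_op_antisym act_antisym_op zinv_A_pair)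
  \<comment> \<open>The z^0 term of \<open>A_pair\<close> cancels, and the outer terms combine to a
    multiple of z - z^-1.\<close>
  also have "A_pair 3 4 zvar - A_pair 3 4 (inverse zvar) =
      (1 - const (par_c / sqrt_q) * const (par_d / sqrt_q)) * (zvar - inverse zvar)"
    by (simp add: A_pair_def field_simps)
  finally show ?thesis
    by (simp add: const.hom_diff const.hom_one power2_eq_square flip: const.hom_mult)
qed

lemma act_G_plus_z: "act G_plus (zvar + inverse zvar) = const (sqrt_q - inverse sqrt_q)"
proof -
  have T: "T_pow n (zvar + inverse zvar) =
      const (sqrt_q powi n) * zvar + const (inverse (sqrt_q powi n)) * inverse zvar" for n
  proof -
    interpret field_hom "T_pow n" by (rule T_pow_hom)
    show ?thesis
      by (simp add: hom_add hom_inverse const.hom_inverse)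
  qed
  have "act G_plus (zvar + inverse zvar) =
      const (sqrt_q - inverse sqrt_q) * (zvar - inverse zvar) / (zvar - inverse zvar)"
    unfolding G_plus_antisym act_antisym_op T
    by (simp add: zinv.hom_one power_int_minus const.hom_diff algebra_simps)
  then show ?thesis
    by simp
qed

text \<open>The test function 1 suffices: the difference operator, a multiple of
  \<open>E_op 3 4\<close>, sends it to a nonzero multiple of 1 - cd/q.\<close>

lemma not_restricts_cG_minus: "\<not> restricts cG_minus"
  unfolding cG_minus_def
proof (rule steinberg_not_restricts[OF sym_lpolys_one])
  show "opshift (axis 1 1) G_minus = antisym_op (zshift (axis 1 1) (A1 zvar))"
    by (simp add: G_minus_antisym opshift_antisym_op pshift_a_hom laurent_A1)
  show "opshift (axis 2 1) G_minus = antisym_op (zshift (axis 2 1) (A1 zvar))"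
    by (simp add: G_minus_antisym opshift_antisym_op pshift_b_hom laurent_A1)
  show "zshift (axis 1 1) (A1 zvar) \<in> laurent" "zshift (axis 2 1) (A1 zvar) \<in> laurent"
    by (simp_all add: laurent_zshift pshift_a_hom pshift_b_hom laurent_A1)
  show "act (antisym_op (zshift (axis 1 1) (A1 zvar) - zshift (axis 2 1) (A1 zvar))) 1 \<noteq> 0"
    unfolding zshift_difference_A1 act_antisym_op_const_mult E_op_antisym[symmetric] act_E_34_one
    using shift_defect_nonzero parameters_generic(4) by (simp add: const.hom_eq_0_iff)
qed

text \<open>The difference operator is a multiple of \<open>G_plus\<close>, which kills constants,
  so z + z^-1 is the simplest possible test function.\<close>

lemma not_restricts_cE1_plus: "\<not> restricts cE1_plus"
  unfolding cE1_plus_def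
proof (rule steinberg_not_restricts)
  show "zvar + inverse zvar \<in> sym_lpolys"
    by (simp add: sym_lpolys_iff laurent_add zinv.hom_add zinv.hom_inverse)
  show "opshift (axis 1 1) (E_op 1 2) = antisym_op (zshift (axis 1 1) (A_pair 1 2 zvar))"
    by (simp add: E_op_antisym opshift_antisym_op pshift_a_hom laurent_A_pair)
  show "opshift (axis 2 1) (E_op 1 2) = antisym_op (zshift (axis 2 1) (A_pair 1 2 zvar))"
    by (simp add: E_op_antisym opshift_antisym_op pshift_b_hom laurent_A_pair)
  show "zshift (axis 1 1) (A_pair 1 2 zvar) \<in> laurent" "zshift (axis 2 1) (A_pair 1 2 zvar) \<in> laurent"
    by (simp_all add: laurent_zshift pshift_a_hom pshift_b_hom laurent_A_pair)
  have "act (antisym_op (const shift_defect)) (zvar + inverse zvar) =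
      const shift_defect * const (sqrt_q - inverse sqrt_q)"
    using act_antisym_op_const_mult[of shift_defect 1 "zvar + inverse zvar"]
    by (simp add: act_G_plus_z flip: G_plus_antisym)
  moreover have "sqrt_q - inverse sqrt_q \<noteq> 0"
    using parameters_generic(5) by (auto simp: field_simps power2_eq_square)
  ultimately show "act (antisym_op (zshift (axis 1 1) (A_pair 1 2 zvar) -
      zshift (axis 2 1) (A_pair 1 2 zvar))) (zvar + inverse zvar) \<noteq> 0"
    unfolding zshift_difference_A_12 using shift_defect_nonzero
    by (simp add: const.hom_eq_0_iff)
qed


section \<open>Leading coefficients at infinity\<close>

text \<open>Regularity at infinity together with the value there. Unlike a single coefficient of the
  expansion, this is compatible with products and with inverses at nonzero values.\<close>

definition value_at_inf :: "zfield \<Rightarrow> pfield \<Rightarrow> bool" where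
  "value_at_inf x v \<longleftrightarrow> (\<exists>F. expand_inf x = fps_to_fls F \<and> fps_nth F 0 = v)"

interpretation expand: field_hom expand_inf
  by (rule expand_inf_hom)

lemma expand_inf_const: "expand_inf (const c) = fls_const c"
  by (simp add: expand_inf_def zsubst_const fls_const_hom)

lemma expand_inf_zvar: "expand_inf zvar = fls_X_inv"
  by (simp add: expand_inf_def zsubst_zvar fls_const_hom)

lemma value_at_inf_const: "value_at_inf (const c) c"
  unfolding value_at_inf_def
  by (rule exI[of _ "fps_const c"]) (simp add: expand_inf_const fps_const_to_fls)

lemma value_at_inf_one: "value_at_inf 1 1"
  using value_at_inf_const[of 1] by (simp add: const.hom_one)

lemma value_at_inf_inverse_zvar: "value_at_inf (inverse zvar) 0"
  unfolding value_at_inf_def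
  by (rule exI[of _ fps_X])
    (simp add: expand.hom_inverse expand_inf_zvar fls_inverse_X_inv)

lemma value_at_inf_diff: "value_at_inf x v \<Longrightarrow> value_at_inf y w \<Longrightarrow> value_at_inf (x - y) (v - w)"
  unfolding value_at_inf_def
  by (metis expand.hom_diff fps_sub_nth fps_to_fls_minus)

lemma value_at_inf_minus: "value_at_inf x v \<Longrightarrow> value_at_inf (- x) (- v)"
  using value_at_inf_diff[of "1 - 1" "1 - 1" x v] value_at_inf_diff[OF value_at_inf_one value_at_inf_one]
  by simp

lemma value_at_inf_mult: "value_at_inf x v \<Longrightarrow> value_at_inf y w \<Longrightarrow> value_at_inf (x * y) (v * w)"
  unfolding value_at_inf_def
  by (metis expand.hom_mult fls_times_fps_to_fls fps_mult_nth_0)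

lemma value_at_inf_inverse:
  assumes "value_at_inf x v" "v \<noteq> 0"
  shows "value_at_inf (inverse x) (inverse v)"
proof -
  obtain F where F: "expand_inf x = fps_to_fls F" "fps_nth F 0 = v"
    using assms(1) by (auto simp: value_at_inf_def)
  then have "expand_inf (inverse x) = fps_to_fls (inverse F)"
    using assms(2)
    by (simp add: expand.hom_inverse fls_inverse_fps_to_fls subdegree_eq_0_iff)
  then show ?thesis
    unfolding value_at_inf_def using F(2) by (intro exI[of _ "inverse F"]) simp
qed

lemma value_at_inf_nth: "value_at_inf x v \<Longrightarrow> fls_nth (expand_inf x) 0 = v"
  by (auto simp: value_at_inf_def)

text \<open>For simple poles at infinity: a factor z moves the leading index from 0 to -1.\<close>

lemma value_at_inf_zvar_mult_nth:
  "value_at_inf x v \<Longrightarrow> fls_nth (expand_inf (zvar * x)) (- 1) = v"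
  by (auto simp: value_at_inf_def expand.hom_mult expand_inf_zvar fls_X_inv_times_conv_shift)

lemma value_at_inf_denominator: "value_at_inf (inverse (1 - inverse zvar * inverse zvar)) 1"
proof -
  have "value_at_inf (1 - inverse zvar * inverse zvar) (1 - 0 * 0)"
    by (intro value_at_inf_diff value_at_inf_one value_at_inf_mult value_at_inf_inverse_zvar)
  then show ?thesis
    using value_at_inf_inverse by fastforce
qed

lemma value_at_inf_factor:
  "value_at_inf (inverse zvar - const u) (- u)" "value_at_inf (1 - const u * inverse zvar) 1"
  using value_at_inf_diff[OF value_at_inf_inverse_zvar value_at_inf_const[of u]]
    value_at_inf_diff[OF value_at_inf_one
      value_at_inf_mult[OF value_at_inf_const[of u] value_at_inf_inverse_zvar]]
  by simp_all

lemma zvar_quotient: "x / (zvar - inverse zvar) = inverse zvar * x * inverse (1 - inverse zvar * inverse zvar)"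
proof -
  have "zvar - inverse zvar = zvar * (1 - inverse zvar * inverse zvar)"
    by (simp add: right_diff_distrib flip: mult.assoc)
  then show ?thesis
    by (simp add: divide_inverse mult_ac)
qed

lemma one_minus_zvar: "1 - const u * zvar = zvar * (inverse zvar - const u)"
  by (simp add: right_diff_distrib mult.commute)

text \<open>Extracting z from each growing factor leaves factors that are regular at infinity, and
  the extracted powers of z cancel completely.\<close>

lemma nth_A_pair:
  "fls_nth (expand_inf (A_pair i j zvar / (zvar - inverse zvar))) 0 =
    - (pars $ i / sqrt_q * (pars $ j / sqrt_q))"
  "fls_nth (expand_inf (- A_pair i j (inverse zvar) / (zvar - inverse zvar))) 0 = 1"
proof -
  let ?u = "pars $ i / sqrt_q" and ?v = "pars $ j / sqrt_q"
  have "A_pair i j zvar / (zvar - inverse zvar) =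
      - ((inverse zvar - const ?u) * (inverse zvar - const ?v)) * inverse (1 - inverse zvar * inverse zvar)"
  proof -
    \<comment> \<open>With free variables for z^-1 and z, the commutative rearrangement stays
      separate from the cancellation \<open>w * z = 1\<close>.\<close>
    have "w * (- w * (z * x) * (z * y)) * D = - (w * z * (w * z) * (x * y)) * D" for w z x y D :: zfield
      by (simp add: mult_ac)
    then have "w * (- w * (z * x) * (z * y)) * D = - (x * y) * D" if "w * z = 1" for w z x y D :: zfield
      by (simp only: that mult_1_left)
    note cancelled = this
    show ?thesis
      unfolding zvar_quotient A_pair_def one_minus_zvar by (rule cancelled) simp
  qed
  moreover have "value_at_inf (- ((inverse zvar - const ?u) * (inverse zvar - const ?v)) *
      inverse (1 - inverse zvar * inverse zvar)) (- ((- ?u) * (- ?v)) * 1)"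
    by (intro value_at_inf_mult value_at_inf_minus value_at_inf_factor value_at_inf_denominator)
  ultimately show "fls_nth (expand_inf (A_pair i j zvar / (zvar - inverse zvar))) 0 = - (?u * ?v)"
    by (simp add: value_at_inf_nth)
  have "- A_pair i j (inverse zvar) / (zvar - inverse zvar) =
      (1 - const ?u * inverse zvar) * (1 - const ?v * inverse zvar) * inverse (1 - inverse zvar * inverse zvar)"
    unfolding zvar_quotient A_pair_def by (simp flip: mult.assoc)
  moreover have "value_at_inf ((1 - const ?u * inverse zvar) * (1 - const ?v * inverse zvar) *
      inverse (1 - inverse zvar * inverse zvar)) (1 * 1 * 1)"
    by (intro value_at_inf_mult value_at_inf_factor value_at_inf_denominator)
  ultimately show "fls_nth (expand_inf (- A_pair i j (inverse zvar) / (zvar - inverse zvar))) 0 = 1"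
    by (simp add: value_at_inf_nth)
qed

text \<open>As for \<open>A_pair\<close>, but one power of z remains: z^4 from the linear factors
  against z^-3 for the first coefficient, z^2 against z^-1 for the second. Hence the index
  -1.\<close>

lemma nth_A1:
  "fls_nth (expand_inf (A1 zvar / (zvar - inverse zvar))) (- 1) =
    inverse sqrt_q * (par_a / sqrt_q * (par_b / sqrt_q) * (par_c / sqrt_q * (par_d / sqrt_q)))"
  "fls_nth (expand_inf (- A1 (inverse zvar) / (zvar - inverse zvar))) (- 1) = - inverse sqrt_q"
proof -
  let ?a = "par_a / sqrt_q" and ?b = "par_b / sqrt_q" and ?c = "par_c / sqrt_q" and ?d = "par_d / sqrt_q"
  let ?D = "inverse (1 - inverse zvar * inverse zvar)"
  have p: "zvar powi (- 2) = inverse zvar * inverse zvar" "inverse zvar powi (- 2) = zvar * zvar"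
    by (simp_all add: power_int_minus power2_eq_square)
  have "A1 zvar / (zvar - inverse zvar) = zvar * (const (inverse sqrt_q) *
      ((inverse zvar - const ?a) * (inverse zvar - const ?b) * ((inverse zvar - const ?c) * (inverse zvar - const ?d))) * ?D)"
  proof -
    have "w * (m * (w * w) * (z * x1 * (z * x2) * (z * x3) * (z * x4))) * D =
        w * z * (w * z) * (w * z) * z * (m * (x1 * x2 * (x3 * x4)) * D)"
      for w z m x1 x2 x3 x4 D :: zfield
      by (simp add: mult_ac)
    then have "w * (m * (w * w) * (z * x1 * (z * x2) * (z * x3) * (z * x4))) * D =
        z * (m * (x1 * x2 * (x3 * x4)) * D)"
      if "w * z = 1" for w z m x1 x2 x3 x4 D :: zfield
      by (simp only: that mult_1_left)
    note cancelled = this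
    show ?thesis
      unfolding zvar_quotient A1_def prod_4 pars_nth one_minus_zvar p by (rule cancelled) simp
  qed
  moreover have "value_at_inf (const (inverse sqrt_q) *
      ((inverse zvar - const ?a) * (inverse zvar - const ?b) * ((inverse zvar - const ?c) * (inverse zvar - const ?d))) * ?D)
      (inverse sqrt_q * (- ?a * - ?b * (- ?c * - ?d)) * 1)"
    by (intro value_at_inf_mult value_at_inf_const value_at_inf_factor value_at_inf_denominator)
  ultimately show "fls_nth (expand_inf (A1 zvar / (zvar - inverse zvar))) (- 1) =
      inverse sqrt_q * (?a * ?b * (?c * ?d))"
    by (simp only: value_at_inf_zvar_mult_nth mult_1_right minus_mult_minus mult_minus_left)
  have "- A1 (inverse zvar) / (zvar - inverse zvar) = zvar * (- (const (inverse sqrt_q) *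
      ((1 - const ?a * inverse zvar) * (1 - const ?b * inverse zvar) *
       ((1 - const ?c * inverse zvar) * (1 - const ?d * inverse zvar)))) * ?D)"
  proof -
    have "w * (- (m * (z * z) * (x1 * x2 * x3 * x4))) * D =
        w * z * z * (- (m * (x1 * x2 * (x3 * x4))) * D)"
      for w z m x1 x2 x3 x4 D :: zfield
      by (simp add: mult_ac)
    then have "w * (- (m * (z * z) * (x1 * x2 * x3 * x4))) * D =
        z * (- (m * (x1 * x2 * (x3 * x4))) * D)"
      if "w * z = 1" for w z m x1 x2 x3 x4 D :: zfield
      by (simp only: that mult_1_left)
    note cancelled = this
    show ?thesis
      unfolding zvar_quotient A1_def prod_4 pars_nth p by (rule cancelled) simp
  qed
  moreover have "value_at_inf (- (const (inverse sqrt_q) *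
      ((1 - const ?a * inverse zvar) * (1 - const ?b * inverse zvar) *
       ((1 - const ?c * inverse zvar) * (1 - const ?d * inverse zvar)))) * ?D)
      (- (inverse sqrt_q * (1 * 1 * (1 * 1))) * 1)"
    by (intro value_at_inf_mult value_at_inf_minus value_at_inf_const value_at_inf_factor
        value_at_inf_denominator)
  ultimately show "fls_nth (expand_inf (- A1 (inverse zvar) / (zvar - inverse zvar))) (- 1) = - inverse sqrt_q"
    by (simp only: value_at_inf_zvar_mult_nth mult_1_right minus_mult_minus mult_minus_left)
qed

section \<open>The Steinberg condition for the operators that fail to restrict\<close>

lemma lookup_eta: "Poly_Mapping.lookup (eta h X) n =
    fls_nth (expand_inf (Poly_Mapping.lookup X n)) \<lfloor>dotp h v1\<rfloor>"
  by (simp add: eta_def map.rep_eq when_def expand.hom_zero)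

lemma subfield_gen_zero: "0 \<in> subfield_gen G"
  using subfield_gen.diff[OF subfield_gen.one subfield_gen.one] by simp

lemma subfield_gen_minus: "x \<in> subfield_gen G \<Longrightarrow> - x \<in> subfield_gen G"
  using subfield_gen.diff[OF subfield_gen_zero] by simp

text \<open>The leading coefficients involve the parameters only through ab and cd, which are
  negative squares of the generators \<open>sqrt_mab\<close> and \<open>sqrt_mcd\<close>.\<close>

lemma parameter_products_in_subfield:
  "inverse sqrt_q \<in> subfield_gen {sqrt_mab, sqrt_mcd, sqrt_q}"
  "par_a / sqrt_q * (par_b / sqrt_q) \<in> subfield_gen {sqrt_mab, sqrt_mcd, sqrt_q}"
  "par_c / sqrt_q * (par_d / sqrt_q) \<in> subfield_gen {sqrt_mab, sqrt_mcd, sqrt_q}"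
proof -
  have "par_a / sqrt_q * (par_b / sqrt_q) = - (sqrt_mab * sqrt_mab * (inverse sqrt_q * inverse sqrt_q))"
    "par_c / sqrt_q * (par_d / sqrt_q) = - (sqrt_mcd * sqrt_mcd * (inverse sqrt_q * inverse sqrt_q))"
    by (simp_all add: par_a_def par_c_def power2_eq_square divide_inverse)
  then show "inverse sqrt_q \<in> subfield_gen {sqrt_mab, sqrt_mcd, sqrt_q}"
    "par_a / sqrt_q * (par_b / sqrt_q) \<in> subfield_gen {sqrt_mab, sqrt_mcd, sqrt_q}"
    "par_c / sqrt_q * (par_d / sqrt_q) \<in> subfield_gen {sqrt_mab, sqrt_mcd, sqrt_q}"
    by (auto intro!: subfield_gen_minus subfield_gen.mult subfield_gen.inv intro: subfield_gen.gen)
qed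

text \<open>As v1 has norm 1, the leading index is -1, and the coefficients are abcd q^(-5/2) and
  -q^(-1/2). So \<open>cG_minus\<close> is a genuine instance of the construction although it does
  not restrict.\<close>

lemma steinberg_cond_G_minus: "steinberg_cond (- v1) G_minus"
proof -
  have "\<lfloor>dotp (- v1) v1\<rfloor> = - 1"
    by (simp add: dotp_def sum_4 floor_eq_iff)
  moreover have "dotp (- v1) v3 = 0" "dotp (- v1) v4 = 0"
    by (simp_all add: dotp_def sum_4)
  moreover have "inverse sqrt_q * (par_a / sqrt_q * (par_b / sqrt_q) * (par_c / sqrt_q * (par_d / sqrt_q)))
      \<in> subfield_gen {sqrt_mab, sqrt_mcd, sqrt_q}"
    by (intro subfield_gen.mult parameter_products_in_subfield)
  moreover have "- inverse sqrt_q \<in> subfield_gen {sqrt_mab, sqrt_mcd, sqrt_q}"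
    by (intro subfield_gen_minus parameter_products_in_subfield)
  ultimately show ?thesis
    unfolding steinberg_cond_def lookup_eta G_minus_antisym lookup_antisym_op zinv_A1
    by (simp only: nth_A1 expand.hom_zero subfield_gen_zero fls_zero_nth split: if_split) simp
qed

text \<open>As v1 and v2 are orthogonal, the leading index is 0, and the coefficients are -ab/q and
  1.\<close>

lemma steinberg_cond_E_12: "steinberg_cond (- v2) (E_op 1 2)"
proof -
  have "\<lfloor>dotp (- v2) v1\<rfloor> = 0"
    by (simp add: dotp_def sum_4)
  moreover have "dotp (- v2) v3 = 0" "dotp (- v2) v4 = 0"
    by (simp_all add: dotp_def sum_4)
  moreover have "- (par_a / sqrt_q * (par_b / sqrt_q)) \<in> subfield_gen {sqrt_mab, sqrt_mcd, sqrt_q}"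
    by (intro subfield_gen_minus parameter_products_in_subfield)
  ultimately show ?thesis
    unfolding steinberg_cond_def lookup_eta E_op_antisym lookup_antisym_op zinv_A_pair
    by (simp only: nth_A_pair pars_nth expand.hom_zero subfield_gen_zero subfield_gen.one fls_zero_nth
        split: if_split) simp
qed

section \<open>Assembly of the general statements and the special cases\<close>

theorem corollary4p33:
  shows
    "(\<forall>h\<in>shifts. \<forall>X\<in>sym_shift_ops h.
        (koornwinder_cond h X \<longrightarrow> restricts_to (koornwinder h X) (act X)) \<and>
        (steinberg_cond h X \<and> opshift (axis 1 1) X = opshift (axis 2 1) X \<and>
           opshift (axis 2 1) X = X \<longrightarrow>
           restricts_to (steinberg h X) (\<lambda>f. const (qpow (- (h $ 1))) * act X f)))
     \<and> restricts_to cE2_plus (act (E_op 1 3))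
     \<and> restricts_to cE2_minus (act (E_op 2 4))
     \<and> restricts_to cG_plus (\<lambda>f. const (qpow (-1/2)) * act G_plus f)
     \<and> restricts_to cE1_minus (\<lambda>f. const (qpow (-1/2)) * act (E_op 3 4) f)
     \<and> steinberg_cond (- v1) G_minus \<and> \<not> restricts cG_minus
     \<and> steinberg_cond (- v2) (E_op 1 2) \<and> \<not> restricts cE1_plus"
proof (intro conjI ballI impI)
  fix h :: "rat ^ 4" and X
  assume h: "h \<in> shifts" and X: "X \<in> sym_shift_ops h"
  then have image: "act X ` sym_lpolys \<subseteq> sym_lpolys"
    by (simp add: sym_shift_ops_def)
  then show "restricts_to (koornwinder h X) (act X)"
    by (rule koornwinder_restricts_to)
  assume *: "steinberg_cond h X \<and> opshift (axis 1 1) X = opshift (axis 2 1) X \<and>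
    opshift (axis 2 1) X = X"
  \<comment> \<open>Adding the conditions on v3 and v4 gives this, since v3 + v4 = (1, -1, 0,
    0).\<close>
  then have "h $ 1 = h $ 2"
    by (simp add: steinberg_cond_def dotp_def sum_4)
  with * image h show "restricts_to (steinberg h X) (\<lambda>f. const (qpow (- (h $ 1))) * act X f)"
    by (intro steinberg_restricts_to) simp_all
next
  show "restricts_to cE2_plus (act (E_op 1 3))" "restricts_to cE2_minus (act (E_op 2 4))"
    unfolding cE2_plus_def cE2_minus_def
    by (intro koornwinder_restricts_to act_E_op_in_sym_lpolys)+
  have "v1 \<in> shifts" "v2 \<in> shifts"
    by (simp_all add: shifts_def)
  then show "restricts_to cG_plus (\<lambda>f. const (qpow (-1/2)) * act G_plus f)"
    "restricts_to cE1_minus (\<lambda>f. const (qpow (-1/2)) * act (E_op 3 4) f)"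
    unfolding cG_plus_def cE1_minus_def
    by (intro steinberg_restricts_to opshift_G_plus opshift_E_34 pshift_a_hom pshift_b_hom
        act_E_op_in_sym_lpolys act_G_plus_in_sym_lpolys; simp)+
qed (fact steinberg_cond_G_minus not_restricts_cG_minus steinberg_cond_E_12 not_restricts_cE1_plus)+

end
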